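(* Let $\alpha\in\left(0,\frac{n+1}{2}\right)$ and let $\mathbf{W}_\alpha=\{\mathbf{W}_\alpha(\varphi);\varphi\in L^2(\mathbb{R}_+;\mathcal{W}^{-\alpha,2})\}$ be the centered Gaussian family with covariance $$\mathbf{E}\left(\mathbf{W}_\alpha(\varphi)\mathbf{W}_\alpha(\psi)\right)=\int_{\mathbb{R}_+}\int_{\mathbf{H}^n}\big[(-\Delta)^{-\alpha}\varphi\big](t,q)\big[(-\Delta)^{-\alpha}\psi\big](t,q)\,d\mu(q)\,dt.$$ Then for every $\theta\in[0,2\pi)$, $$\{\mathbf{W}_\alpha(\varphi\circ R_\theta);\ \varphi\in L^2(\mathbb{R}_+;\mathcal{W}^{-\alpha,2})\}\stackrel{\mathcal{D}}{=}\{\mathbf{W}_\alpha(\varphi);\ \varphi\in L^2(\mathbb{R}_+;\mathcal{W}^{-\alpha,2})\}.$$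
   Context: Let $n\ge1$. The Heisenberg group $\mathbf{H}^n$ is $\mathbb{R}^n\times\mathbb{R}^n\times\mathbb{R}$ with product $(x,y,z)\star(x',y',z')=(x+x',y+y',z+z'+2\sum_{i=1}^n(x_i'y_i-x_iy_i'))$; $\mu$ is Lebesgue measure on $\mathbb{R}^{2n+1}$. Let $X_i=\partial_{x_i}+2y_i\partial_z$, $Y_i=\partial_{y_i}-2x_i\partial_z$ and $\Delta=\sum_{i=1}^n(X_i^2+Y_i^2)$, essentially self-adjoint on $C_0^\infty(\mathbb{R}^{2n+1})\subset L^2(\mathbf{H}^n,\mu)$; $\Delta$ also denotes its self-adjoint extension, and $(-\Delta)^{-\alpha}$ is defined by the spectral theorem, with domain $\mathcal{W}^{-\alpha,2}\subset L^2(\mathbf{H}^n,\mu)$. $L^2(\mathbb{R}_+;\mathcal{W}^{-\alpha,2})$ is the space of measurable $\varphi$ on $\mathbb{R}_+\times\mathbf{H}^n$ with $\varphi(t,\cdot)\in\mathcal{W}^{-\alpha,2}$ for a.e. $t$ and $\int_{\mathbb{R}_+}\|(-\Delta)^{-\alpha}\varphi(t,\cdot)\|_{L^2(\mu)}^2dt<\infty$. The horizontal rotation is $R_\theta(x,y,z)=((\cos\theta)x+(\sin\theta)y,\,-(\sin\theta)x+(\cos\theta)y,\,z)$ for $x,y\in\mathbb{R}^n$, $z\in\mathbb{R}$, and $(\varphi\circ R_\theta)(t,q)=\varphi(t,R_\theta q)$. $\stackrel{\mathcal{D}}{=}$ denotes equality in law of the two families. *)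

theory Defs
  imports "HOL-Probability.Probability"
begin

section \<open>The Hilbert space of square integrable functions\<close>

definition sq_integrable :: "('a::euclidean_space \<Rightarrow> real) \<Rightarrow> bool" where
  "sq_integrable f \<longleftrightarrow> f \<in> borel_measurable lborel \<and> integrable lborel (\<lambda>x. (f x)\<^sup>2)"

lemma sq_integrable_zero: "sq_integrable (\<lambda>_. 0)"
  by (simp add: sq_integrable_def)

lemma sq_integrable_mult:
  assumes "sq_integrable f" "sq_integrable g"
  shows "integrable lborel (\<lambda>x. f x * g x)"
proof (rule Bochner_Integration.integrable_bound)
  show "integrable lborel (\<lambda>x. (f x)\<^sup>2 + (g x)\<^sup>2)"
    using assms by (auto simp: sq_integrable_def)
  show "(\<lambda>x. f x * g x) \<in> borel_measurable lborel"
    using assms by (auto simp: sq_integrable_def)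
  have "\<bar>a * b\<bar> \<le> a\<^sup>2 + b\<^sup>2" for a b :: real
  proof -
    have "2 * (\<bar>a\<bar> * \<bar>b\<bar>) \<le> a\<^sup>2 + b\<^sup>2"
      using sum_squares_bound[of "\<bar>a\<bar>" "\<bar>b\<bar>"] by (simp add: mult.assoc)
    moreover have "0 \<le> \<bar>a\<bar> * \<bar>b\<bar>" by simp
    ultimately have "\<bar>a\<bar> * \<bar>b\<bar> \<le> a\<^sup>2 + b\<^sup>2" by linarith
    then show ?thesis by (simp add: abs_mult)
  qed
  then show "AE x in lborel. norm (f x * g x) \<le> norm ((f x)\<^sup>2 + (g x)\<^sup>2)"
    by auto
qed

lemma sq_integrable_add:
  assumes "sq_integrable f" "sq_integrable g"
  shows "sq_integrable (\<lambda>x. f x + g x)"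
proof -
  have "integrable lborel (\<lambda>x. (f x)\<^sup>2 + (g x)\<^sup>2 + 2 * (f x * g x))"
    using assms sq_integrable_mult[OF assms] by (auto simp: sq_integrable_def)
  moreover have "(\<lambda>x. (f x)\<^sup>2 + (g x)\<^sup>2 + 2 * (f x * g x)) = (\<lambda>x. (f x + g x)\<^sup>2)"
    by (auto simp: power2_eq_square algebra_simps)
  ultimately show ?thesis
    using assms by (auto simp: sq_integrable_def)
qed

lemma sq_integrable_scale: "sq_integrable f \<Longrightarrow> sq_integrable (\<lambda>x. c * f x)"
  by (auto simp: sq_integrable_def power_mult_distrib)

definition L2_rel :: "('a::euclidean_space \<Rightarrow> real) \<Rightarrow> ('a \<Rightarrow> real) \<Rightarrow> bool" where
  "L2_rel f g \<longleftrightarrow> sq_integrable f \<and> sq_integrable g \<and> (AE x in lborel. f x = g x)"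

lemma L2_rel_part_equivp: "part_equivp (L2_rel :: ('a::euclidean_space \<Rightarrow> real) \<Rightarrow> _)"
proof (rule part_equivpI)
  show "\<exists>f :: 'a \<Rightarrow> real. L2_rel f f"
    by (intro exI[of _ "\<lambda>_. 0"]) (simp add: L2_rel_def sq_integrable_zero)
  show "symp (L2_rel :: ('a \<Rightarrow> real) \<Rightarrow> _)"
    by (rule sympI) (auto simp: L2_rel_def elim: eventually_mono)
  show "transp (L2_rel :: ('a \<Rightarrow> real) \<Rightarrow> _)"
  proof (rule transpI)
    fix f g h :: "'a \<Rightarrow> real"
    assume fg: "L2_rel f g" and gh: "L2_rel g h"
    have "AE x in lborel. f x = g x" "AE x in lborel. g x = h x"
      using fg gh by (auto simp: L2_rel_def)
    then have "AE x in lborel. f x = h x" by eventually_elim simp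
    then show "L2_rel f h" using fg gh by (simp add: L2_rel_def)
  qed
qed

quotient_type (overloaded) 'a L2 = "'a::euclidean_space \<Rightarrow> real" / partial: L2_rel
  morphisms rep_L2 abs_L2
  by (rule L2_rel_part_equivp)

instantiation L2 :: (euclidean_space) real_inner
begin

lift_definition zero_L2 :: "'a L2" is "\<lambda>_. 0"
  by (simp add: L2_rel_def sq_integrable_zero)

lift_definition plus_L2 :: "'a L2 \<Rightarrow> 'a L2 \<Rightarrow> 'a L2" is "\<lambda>f g x. f x + g x"
proof -
  fix f f' g g' :: "'a \<Rightarrow> real"
  assume f: "L2_rel f f'" and g: "L2_rel g g'"
  have "AE x in lborel. f x = f' x" "AE x in lborel. g x = g' x"
    using f g by (auto simp: L2_rel_def)
  then have "AE x in lborel. f x + g x = f' x + g' x" by eventually_elim simp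
  then show "L2_rel (\<lambda>x. f x + g x) (\<lambda>x. f' x + g' x)"
    using f g by (simp add: L2_rel_def sq_integrable_add)
qed

lift_definition scaleR_L2 :: "real \<Rightarrow> 'a L2 \<Rightarrow> 'a L2" is "\<lambda>c f x. c * f x"
  by (auto simp: L2_rel_def sq_integrable_scale elim: eventually_mono)

definition uminus_L2 :: "'a L2 \<Rightarrow> 'a L2" where
  "uminus_L2 u = (-1) *\<^sub>R u"

definition minus_L2 :: "'a L2 \<Rightarrow> 'a L2 \<Rightarrow> 'a L2" where
  "minus_L2 u v = u + (- v)"

lift_definition inner_L2 :: "'a L2 \<Rightarrow> 'a L2 \<Rightarrow> real" is
  "\<lambda>f g. \<integral>x. f x * g x \<partial>lborel"
proof -
  fix f f' g g' :: "'a \<Rightarrow> real"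
  assume f: "L2_rel f f'" and g: "L2_rel g g'"
  have "AE x in lborel. f x = f' x" "AE x in lborel. g x = g' x"
    using f g by (auto simp: L2_rel_def)
  then have "AE x in lborel. f x * g x = f' x * g' x" by eventually_elim simp
  then show "(\<integral>x. f x * g x \<partial>lborel) = (\<integral>x. f' x * g' x \<partial>lborel)"
    using f g by (intro integral_cong_AE) (auto simp: L2_rel_def sq_integrable_def)
qed

definition norm_L2 :: "'a L2 \<Rightarrow> real" where
  "norm_L2 u = sqrt (inner u u)"

definition sgn_L2 :: "'a L2 \<Rightarrow> 'a L2" where
  "sgn_L2 u = inverse (norm u) *\<^sub>R u"

definition dist_L2 :: "'a L2 \<Rightarrow> 'a L2 \<Rightarrow> real" where
  "dist_L2 u v = norm (u - v)"

definition uniformity_L2 :: "('a L2 \<times> 'a L2) filter" where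
  "uniformity_L2 = (INF e\<in>{0<..}. principal {(u, v). dist u v < e})"

definition open_L2 :: "'a L2 set \<Rightarrow> bool" where
  "open_L2 U \<longleftrightarrow> (\<forall>u\<in>U. eventually (\<lambda>(u', v). u' = u \<longrightarrow> v \<in> U) uniformity)"

instance
proof
  fix u v w :: "'a L2" and a b :: real and U :: "'a L2 set"
  show "u + v + w = u + (v + w)"
    by transfer (auto simp: L2_rel_def add.assoc intro!: sq_integrable_add)
  show "u + v = v + u"
    by transfer (auto simp: L2_rel_def add.commute intro!: sq_integrable_add)
  show "0 + u = u"
    by transfer (auto simp: L2_rel_def)
  have neg: "(-1) *\<^sub>R u + u = 0"
    by transfer (auto simp: L2_rel_def sq_integrable_zero)
  show "- u + u = 0"
    using neg by (simp only: uminus_L2_def)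
  show "u - v = u + - v" by (rule minus_L2_def)
  show "a *\<^sub>R (u + v) = a *\<^sub>R u + a *\<^sub>R v"
    by transfer (auto simp: L2_rel_def distrib_left
        intro!: sq_integrable_add sq_integrable_scale)
  show "(a + b) *\<^sub>R u = a *\<^sub>R u + b *\<^sub>R u"
    by transfer (auto simp: L2_rel_def distrib_right
        intro!: sq_integrable_add sq_integrable_scale)
  show "a *\<^sub>R b *\<^sub>R u = (a * b) *\<^sub>R u"
    by transfer (auto simp: L2_rel_def mult.assoc intro!: sq_integrable_scale)
  show "1 *\<^sub>R u = u"
    by transfer (auto simp: L2_rel_def)
  show "dist u v = norm (u - v)" by (rule dist_L2_def)
  show "sgn u = inverse (norm u) *\<^sub>R u" by (rule sgn_L2_def)
  show "(uniformity :: ('a L2 \<times> 'a L2) filter) = (INF e\<in>{0<..}. principal {(x, y). dist x y < e})"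
    by (rule uniformity_L2_def)
  show "open U = (\<forall>x\<in>U. \<forall>\<^sub>F (x', y) in uniformity. x' = x \<longrightarrow> y \<in> U)"
    by (rule open_L2_def)
  show "inner u v = inner v u"
    by transfer (simp add: mult.commute)
  show "inner (u + v) w = inner u w + inner v w"
    by transfer (simp add: L2_rel_def distrib_right sq_integrable_mult)
  show "inner (a *\<^sub>R u) v = a * inner u v"
    by transfer (simp add: mult.assoc)
  show "0 \<le> inner u u"
    by transfer simp
  show "(inner u u = 0) = (u = 0)"
  proof transfer
    fix f :: "'a \<Rightarrow> real"
    assume "L2_rel f f"
    then have f: "sq_integrable f" by (simp add: L2_rel_def)
    have "(\<integral>x. f x * f x \<partial>lborel) = 0 \<longleftrightarrow> (AE x in lborel. f x * f x = 0)"
      using sq_integrable_mult[OF f f] by (intro integral_nonneg_eq_0_iff_AE) auto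
    then show "((\<integral>x. f x * f x \<partial>lborel) = 0) = L2_rel f (\<lambda>_. 0)"
      using f by (simp add: L2_rel_def sq_integrable_zero)
  qed
  show "norm u = sqrt (inner u u)" by (rule norm_L2_def)
qed

end


section \<open>Spectral calculus\<close>

text \<open>Unbounded operators are represented by their graphs.\<close>

definition projection_valued_measure :: "(real set \<Rightarrow> 'h::real_inner \<Rightarrow> 'h) \<Rightarrow> bool" where
  "projection_valued_measure E \<longleftrightarrow>
     (\<forall>B\<in>sets borel. linear (E B) \<and> (\<forall>u v. inner (E B u) v = inner u (E B v))) \<and>
     E UNIV = id \<and>
     (\<forall>B\<in>sets borel. \<forall>C\<in>sets borel. E (B \<inter> C) = E B \<circ> E C) \<and>
     (\<forall>B :: nat \<Rightarrow> real set. range B \<subseteq> sets borel \<longrightarrow> disjoint_family B \<longrightarrow>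
        (\<forall>u. (\<lambda>i. E (B i) u) sums E (\<Union>i. B i) u))"

definition spectral_measure :: "(real set \<Rightarrow> 'h::real_inner \<Rightarrow> 'h) \<Rightarrow> 'h \<Rightarrow> real measure" where
  "spectral_measure E u = measure_of UNIV (sets borel) (\<lambda>B. ennreal (inner (E B u) u))"

definition spectral_domain ::
    "(real set \<Rightarrow> 'h::real_inner \<Rightarrow> 'h) \<Rightarrow> (real \<Rightarrow> real) \<Rightarrow> 'h set" where
  "spectral_domain E f = {u. integrable (spectral_measure E u) (\<lambda>x. (f x)\<^sup>2)}"

text \<open>
  The graph of the operator that is the integral of \<open>f\<close> against \<open>E\<close>, determined by
  its form: the inner product of \<open>v\<close> and \<open>w\<close> is the integral of \<open>f\<close> against the signed
  measure \<open>B \<mapsto> inner (E B u) w\<close>, written by polarization.  Testing against \<open>w\<close> in the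
  (dense) domain ensures that both integrals are finite.
\<close>

definition spectral_integral ::
    "(real set \<Rightarrow> 'h::real_inner \<Rightarrow> 'h) \<Rightarrow> (real \<Rightarrow> real) \<Rightarrow> ('h \<times> 'h) set" where
  "spectral_integral E f = {(u, v). u \<in> spectral_domain E f \<and>
     (\<forall>w\<in>spectral_domain E f.
        inner v w = ((\<integral>x. f x \<partial>spectral_measure E (u + w))
                   - (\<integral>x. f x \<partial>spectral_measure E (u - w))) / 4)}"

text \<open>
  The operator \<open>f(A)\<close>.  By the spectral theorem a self-adjoint \<open>A\<close> has exactly one spectral
  resolution \<open>E\<close>, so the union is over a single \<open>E\<close>.
\<close>

definition spectral_fun :: "(real \<Rightarrow> real) \<Rightarrow> ('h::real_inner \<times> 'h) set \<Rightarrow> ('h \<times> 'h) set" where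
  "spectral_fun f A = (\<Union>E\<in>{E. projection_valued_measure E \<and> spectral_integral E (\<lambda>x. x) = A}.
     spectral_integral E f)"


section \<open>The sub-Laplacian on the Heisenberg group\<close>

type_synonym 'n heis = "(real ^ 'n) \<times> (real ^ 'n) \<times> real"

primrec Ck :: "nat \<Rightarrow> ('a::real_normed_vector \<Rightarrow> real) \<Rightarrow> bool" where
  "Ck 0 f \<longleftrightarrow> continuous_on UNIV f"
| "Ck (Suc k) f \<longleftrightarrow> (\<forall>q. f differentiable (at q)) \<and>
     (\<forall>v. Ck k (\<lambda>q. frechet_derivative f (at q) v))"

definition test_function :: "('a::real_normed_vector \<Rightarrow> real) \<Rightarrow> bool" where
  "test_function f \<longleftrightarrow> (\<forall>k. Ck k f) \<and> compact (closure {q. f q \<noteq> 0})"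

text \<open>
  The group law \<open>(x, y, z) (x', y', z') = (x + x', y + y', z + z' + 2 (x' \<bullet> y - x \<bullet> y'))\<close>
  enters only through its left-invariant fields \<open>X\<^sub>i = \<partial>x\<^sub>i + 2 y\<^sub>i \<partial>z\<close> and
  \<open>Y\<^sub>i = \<partial>y\<^sub>i - 2 x\<^sub>i \<partial>z\<close>, and its Haar measure is \<open>lborel\<close>.
\<close>

definition X_field :: "'n::finite \<Rightarrow> ('n heis \<Rightarrow> real) \<Rightarrow> 'n heis \<Rightarrow> real" where
  "X_field i f = (\<lambda>(x, y, z).
     frechet_derivative f (at (x, y, z)) (axis i 1, 0, 0)
     + 2 * (y $ i) * frechet_derivative f (at (x, y, z)) (0, 0, 1))"

definition Y_field :: "'n::finite \<Rightarrow> ('n heis \<Rightarrow> real) \<Rightarrow> 'n heis \<Rightarrow> real" where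
  "Y_field i f = (\<lambda>(x, y, z).
     frechet_derivative f (at (x, y, z)) (0, axis i 1, 0)
     - 2 * (x $ i) * frechet_derivative f (at (x, y, z)) (0, 0, 1))"

definition sub_laplacian :: "('n::finite heis \<Rightarrow> real) \<Rightarrow> 'n heis \<Rightarrow> real" where
  "sub_laplacian f q =
     (\<Sum>i\<in>UNIV. X_field i (X_field i f) q + Y_field i (Y_field i f) q)"

text \<open>
  The sub-Laplacian is essentially self-adjoint on test functions, so its self-adjoint
  extension is its closure.
\<close>

definition sub_laplacian_sa :: "('n::finite heis L2 \<times> 'n heis L2) set" where
  "sub_laplacian_sa = closure {(abs_L2 f, abs_L2 (sub_laplacian f)) | f. test_function f}"

definition neg_op :: "('h::real_inner \<times> 'h) set \<Rightarrow> ('h \<times> 'h) set" where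
  "neg_op A = {(u, - v) | u v. (u, v) \<in> A}"

text \<open>
  The values \<open>x powr (- \<alpha>)\<close> for \<open>x \<le> 0\<close> are irrelevant: the negated sub-Laplacian is
  nonnegative and injective, hence its spectral resolution vanishes on \<open>{..0}\<close>.
\<close>

definition neg_laplacian_power :: "real \<Rightarrow> ('n::finite heis L2 \<times> 'n heis L2) set" where
  "neg_laplacian_power \<alpha> = spectral_fun (\<lambda>x. x powr (- \<alpha>)) (neg_op sub_laplacian_sa)"

definition sobolev :: "real \<Rightarrow> ('n::finite heis \<Rightarrow> real) set" where
  "sobolev \<alpha> = {f. sq_integrable f \<and> abs_L2 f \<in> Domain (neg_laplacian_power \<alpha>)}"

text \<open>A representative of the class of the image; only integrals over \<open>q\<close> of it are used.\<close>

definition frac_lap :: "real \<Rightarrow> ('n::finite heis \<Rightarrow> real) \<Rightarrow> 'n heis \<Rightarrow> real" where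
  "frac_lap \<alpha> f = (if f \<in> sobolev \<alpha>
     then rep_L2 (THE v. (abs_L2 f, v) \<in> neg_laplacian_power \<alpha>) else (\<lambda>_. 0))"

abbreviation half_line :: "real measure" where
  "half_line \<equiv> restrict_space lborel {0..}"

definition L2_sobolev :: "real \<Rightarrow> (real \<Rightarrow> 'n::finite heis \<Rightarrow> real) set" where
  "L2_sobolev \<alpha> = {\<phi>.
     case_prod \<phi> \<in> borel_measurable (half_line \<Otimes>\<^sub>M lborel) \<and>
     (AE t in half_line. \<phi> t \<in> sobolev \<alpha>) \<and>
     (\<integral>\<^sup>+ t. (\<integral>\<^sup>+ q. ennreal ((frac_lap \<alpha> (\<phi> t) q)\<^sup>2) \<partial>lborel) \<partial>half_line) < \<infinity>}"

definition horizontal_rotation :: "real \<Rightarrow> 'n::finite heis \<Rightarrow> 'n heis" where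
  "horizontal_rotation \<theta> = (\<lambda>(x, y, z).
     (cos \<theta> *\<^sub>R x + sin \<theta> *\<^sub>R y, - sin \<theta> *\<^sub>R x + cos \<theta> *\<^sub>R y, z))"

definition rotate_field ::
    "real \<Rightarrow> (real \<Rightarrow> 'n::finite heis \<Rightarrow> real) \<Rightarrow> real \<Rightarrow> 'n heis \<Rightarrow> real" where
  "rotate_field \<theta> \<phi> t q = \<phi> t (horizontal_rotation \<theta> q)"


section \<open>Gaussian families\<close>

text \<open>Centered normal laws include the Dirac mass at 0.\<close>

definition centered_normal :: "'w measure \<Rightarrow> ('w \<Rightarrow> real) \<Rightarrow> bool" where
  "centered_normal M X \<longleftrightarrow> X \<in> borel_measurable M \<and>
     ((AE \<omega> in M. X \<omega> = 0) \<or> (\<exists>\<sigma>>0. distributed M lborel X (normal_density 0 \<sigma>)))"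

definition centered_gaussian_family :: "'w measure \<Rightarrow> 'i set \<Rightarrow> ('i \<Rightarrow> 'w \<Rightarrow> real) \<Rightarrow> bool" where
  "centered_gaussian_family M I W \<longleftrightarrow>
     (\<forall>J c. finite J \<longrightarrow> J \<subseteq> I \<longrightarrow> centered_normal M (\<lambda>\<omega>. \<Sum>j\<in>J. c j * W j \<omega>))"

text \<open>
  Equality of laws on the product sigma-algebra is the same as equality of all
  finite-dimensional distributions.
\<close>

definition family_law :: "'w measure \<Rightarrow> 'i set \<Rightarrow> ('i \<Rightarrow> 'w \<Rightarrow> real) \<Rightarrow> ('i \<Rightarrow> real) measure" where
  "family_law M I W = distr M (Pi\<^sub>M I (\<lambda>_. borel)) (\<lambda>\<omega>. \<lambda>i\<in>I. W i \<omega>)"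

end

theory Submission
  imports Defs
begin

text \<open>
  The rotation is orthogonal, so it preserves Lebesgue measure and acts on the Hilbert space as a
  unitary operator \<open>U\<close>.  It sends each pair \<open>X\<^sub>i, Y\<^sub>i\<close> to a rotated pair, so the
  sub-Laplacian on test functions, hence also its closure, commutes with \<open>U\<close>.  Conjugation by
  \<open>U\<close> therefore maps a spectral resolution of the operator to a spectral resolution of the same
  operator, and since that resolution is unique, \<open>U\<close> commutes with the fractional powers.  So the
  covariance is invariant, and a centered Gaussian family is determined in law by its covariance.
\<close>

section \<open>Laws of centered Gaussian families\<close>

text \<open>Conjugation by a rotation shows only that the graph of the fractional power is carried
  into itself. \<open>frac_lap\<close> selects its value with \<open>THE\<close>, and
  \<open>spectral_fun\<close> is a union over all resolutions of the operator, so a rotation can be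
  pulled through \<open>frac_lap\<close> only if that union is single valued. This forces a
  uniqueness proof for resolutions whose integrals are given through quadratic forms of an unbounded
  operator. It works on compact intervals: there the operator is bounded and is rebuilt from
  projections by a norm convergent series, which is where completeness of \<open>L2\<close> enters,
  and growth rates of its iterates detect the spectral subspace. On the probabilistic side the law
  lives on a product over an arbitrary index set, so it is compared on finite-dimensional cylinders.
  The covariance controls exactly the variances of finite linear combinations, and their
  one-dimensional laws have to be assembled into joint laws.\<close>

lemma weighted_char:
  fixes X w :: "'w \<Rightarrow> real"
  assumes [measurable]: "X \<in> borel_measurable M" "w \<in> borel_measurable M"
    and w: "integrable M w" "\<And>x. 0 \<le> w x"
  shows "char (distr (density M (\<lambda>x. ennreal (w x))) borel X) t =
    Complex (\<integral>x. w x * cos (t * X x) \<partial>M) (\<integral>x. w x * sin (t * X x) \<partial>M)"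
proof -
  have int: "integrable M (\<lambda>x. w x *\<^sub>R iexp (t * X x))"
    by (rule Bochner_Integration.integrable_bound[OF w(1)]) auto
  have "char (distr (density M (\<lambda>x. ennreal (w x))) borel X) t = (\<integral>x. w x *\<^sub>R iexp (t * X x) \<partial>M)"
    unfolding char_def using w(2)
    by (subst integral_distr) (auto simp: integral_density)
  also have "\<dots> = Complex (\<integral>x. w x * cos (t * X x) \<partial>M) (\<integral>x. w x * sin (t * X x) \<partial>M)"
    using integral_Re[OF int] integral_Im[OF int]
    by (intro complex_eqI) (auto simp: Re_exp Im_exp)
  finally show ?thesis .
qed

text \<open>Taking \<open>t = 0\<close> in the cosine identity shows that both weights have the same
  total mass \<open>m\<close>. If \<open>m = 0\<close> both vanish almost everywhere; otherwise
  division by \<open>m\<close> gives two probability laws with the same characteristic function, and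
  Levy's uniqueness theorem applies.\<close>

lemma weighted_law_unique:
  fixes X X' w w' :: "'w \<Rightarrow> real"
  assumes [measurable]: "X \<in> borel_measurable M" "X' \<in> borel_measurable M" "B \<in> sets borel"
    and w: "integrable M w" "\<And>x. 0 \<le> w x" and w': "integrable M w'" "\<And>x. 0 \<le> w' x"
    and cos: "\<And>t. (\<integral>x. w x * cos (t * X x) \<partial>M) = (\<integral>x. w' x * cos (t * X' x) \<partial>M)"
    and sin: "\<And>t. (\<integral>x. w x * sin (t * X x) \<partial>M) = (\<integral>x. w' x * sin (t * X' x) \<partial>M)"
  shows "(\<integral>x. w x * indicator B (X x) \<partial>M) = (\<integral>x. w' x * indicator B (X' x) \<partial>M)"
proof -
  have [measurable]: "w \<in> borel_measurable M" "w' \<in> borel_measurable M"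
    using w(1) w'(1) by auto
  define m where "m = (\<integral>x. w x \<partial>M)"
  have m': "m = (\<integral>x. w' x \<partial>M)"
    using cos[of 0] by (simp add: m_def)
  show ?thesis
  proof (cases "m = 0")
    case True
    have "AE x in M. w x = 0" "AE x in M. w' x = 0"
      using True m' w w' integral_nonneg_eq_0_iff_AE[of M w] integral_nonneg_eq_0_iff_AE[of M w']
      by (auto simp: m_def)
    then have "(\<integral>x. w x * indicator B (X x) \<partial>M) = 0" "(\<integral>x. w' x * indicator B (X' x) \<partial>M) = 0"
      by (auto intro!: integral_eq_zero_AE elim: eventually_mono)
    then show ?thesis by simp
  next
    case False
    then have m: "m > 0" using w(2) by (simp add: m_def order.not_eq_order_implies_strict)
    define N where "N v Y = distr (density M (\<lambda>x. ennreal (v x / m))) borel Y" for v Y :: "'w \<Rightarrow> real"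
    have rd: "real_distribution (N v Y)"
      if [measurable]: "v \<in> borel_measurable M" "Y \<in> borel_measurable M"
        and v: "integrable M v" "\<And>x. 0 \<le> v x" "(\<integral>x. v x \<partial>M) = m" for v Y
    proof -
      have "(\<integral>\<^sup>+x. ennreal (v x / m) \<partial>M) = ennreal (\<integral>x. v x / m \<partial>M)"
        using v m by (intro nn_integral_eq_integral) auto
      then have "prob_space (density M (\<lambda>x. ennreal (v x / m)))"
        using v m by (intro prob_spaceI) (simp add: emeasure_density)
      then have "prob_space (N v Y)"
        unfolding N_def by (rule prob_space.prob_space_distr) simp
      then show ?thesis
        unfolding real_distribution_def real_distribution_axioms_def by (simp add: N_def)
    qed
    have char: "char (N v Y) t = Complex ((\<integral>x. v x * cos (t * Y x) \<partial>M) / m) ((\<integral>x. v x * sin (t * Y x) \<partial>M) / m)"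
      if [measurable]: "v \<in> borel_measurable M" "Y \<in> borel_measurable M"
        and v: "integrable M v" "\<And>x. 0 \<le> v x" for v Y t
      unfolding N_def using weighted_char[of Y M "\<lambda>x. v x / m" t] m v by simp
    have "N w X = N w' X'"
      by (rule Levy_uniqueness) (use w w' m' in \<open>auto intro!: rd simp: m_def[symmetric] char cos sin\<close>)
    moreover have "measure (N v Y) B = (\<integral>x. v x * indicator B (Y x) \<partial>M) / m"
      if [measurable]: "v \<in> borel_measurable M" "Y \<in> borel_measurable M"
        and v: "integrable M v" "\<And>x. 0 \<le> v x" for v Y
    proof -
      have "integrable M (\<lambda>x. v x * indicator B (Y x))"
        by (rule Bochner_Integration.integrable_bound[OF v(1)]) (auto simp: indicator_def)
      then have "emeasure (N v Y) B = ennreal (\<integral>x. v x / m * indicator B (Y x) \<partial>M)"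
        unfolding N_def using m v
        by (subst nn_integral_eq_integral[symmetric])
           (auto simp: emeasure_distr emeasure_density ennreal_mult' ennreal_indicator[symmetric]
              intro!: nn_integral_cong split: split_indicator)
      then show ?thesis
        using m v by (simp add: measure_def)
    qed
    ultimately have "(\<integral>x. w x * indicator B (X x) \<partial>M) / m = (\<integral>x. w' x * indicator B (X' x) \<partial>M) / m"
      using w w' by (metis \<open>w \<in> borel_measurable M\<close> \<open>w' \<in> borel_measurable M\<close> assms(1,2))
    then show ?thesis using m by simp
  qed
qed

section \<open>Centered normal variables and their second moments\<close>

lemma (in prob_space) centered_normal_sq_integrable:
  assumes "centered_normal M X"
  shows "integrable M (\<lambda>x. (X x)\<^sup>2)"
proof -
  from assms have [measurable]: "X \<in> borel_measurable M" by (simp add: centered_normal_def)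
  from assms consider "AE \<omega> in M. X \<omega> = 0" | \<sigma> where "\<sigma> > 0" "distributed M lborel X (normal_density 0 \<sigma>)"
    by (auto simp: centered_normal_def)
  then show ?thesis
  proof cases
    case 1
    then have "AE \<omega> in M. (X \<omega>)\<^sup>2 = 0" by eventually_elim simp
    then show ?thesis by (subst integrable_cong_AE[of _ _ "\<lambda>_. 0"]) auto
  next
    case 2
    then show ?thesis
      using integrable_normal_moment[of \<sigma> 0 2]
      by (subst distributed_integrable[OF 2(2), symmetric]) auto
  qed
qed

text \<open>The mean is zero, so the second moment is \<sigma> squared. This makes the existentially
  quantified \<sigma> explicit and puts two variables with equal second moments into the same
  alternative, Dirac or Gaussian.\<close>

lemma (in prob_space) centered_normal_law:
  assumes "centered_normal M X"
  shows "(AE x in M. X x = 0) \<and> (\<integral>x. (X x)\<^sup>2 \<partial>M) = 0 \<or>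
    (\<integral>x. (X x)\<^sup>2 \<partial>M) > 0 \<and>
    distributed M lborel X (normal_density 0 (sqrt (\<integral>x. (X x)\<^sup>2 \<partial>M)))"
proof -
  from assms have [measurable]: "X \<in> borel_measurable M" by (simp add: centered_normal_def)
  from assms consider "AE \<omega> in M. X \<omega> = 0" | \<sigma> where "\<sigma> > 0" "distributed M lborel X (normal_density 0 \<sigma>)"
    by (auto simp: centered_normal_def)
  then show ?thesis
  proof cases
    case 1
    then have "AE \<omega> in M. (X \<omega>)\<^sup>2 = 0" by eventually_elim simp
    then show ?thesis using 1 by (simp add: integral_eq_zero_AE)
  next
    case 2
    have "(\<integral>x. (X x)\<^sup>2 \<partial>M) = \<sigma>\<^sup>2"
      using normal_distributed_variance[OF 2] normal_distributed_expectation[OF 2] 2 by simp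
    with 2 show ?thesis by simp
  qed
qed

lemma (in prob_space) centered_normal_integral_eq:
  fixes g :: "real \<Rightarrow> real"
  assumes X: "centered_normal M X" and Y: "centered_normal M Y"
    and eq: "(\<integral>x. (X x)\<^sup>2 \<partial>M) = (\<integral>x. (Y x)\<^sup>2 \<partial>M)"
    and [measurable]: "g \<in> borel_measurable borel"
  shows "(\<integral>x. g (X x) \<partial>M) = (\<integral>x. g (Y x) \<partial>M)"
proof -
  from X Y have [measurable]: "X \<in> borel_measurable M" "Y \<in> borel_measurable M"
    by (auto simp: centered_normal_def)
  consider "AE x in M. X x = 0" "AE x in M. Y x = 0"
    | \<sigma> where "distributed M lborel X (normal_density 0 \<sigma>)" "distributed M lborel Y (normal_density 0 \<sigma>)"
    using centered_normal_law[OF X] centered_normal_law[OF Y] eq by auto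
  then show ?thesis
  proof cases
    case 1
    from 1 have "AE x in M. g (X x) = g (Y x)" by eventually_elim simp
    then show ?thesis by (intro integral_cong_AE) auto
  next
    case 2
    show ?thesis
      using distributed_integral[OF 2(1), of g] distributed_integral[OF 2(2), of g] by simp
  qed
qed

section \<open>From trigonometric moments of linear combinations to joint laws\<close>

lemma integrable_weighted_bounded:
  fixes w h :: "'w \<Rightarrow> real"
  assumes "integrable M w" "h \<in> borel_measurable M" "\<And>x. \<bar>h x\<bar> \<le> 1"
  shows "integrable M (\<lambda>x. w x * h x)"
  by (rule Bochner_Integration.integrable_bound[OF assms(1)])
    (use assms in \<open>auto simp: abs_mult intro!: mult_left_le\<close>)

text \<open>
  A Cramer--Wold device that needs only the one-dimensional uniqueness theorem: the factors
  \<open>cos\<close> and \<open>sin\<close> of a linear combination are traded, one coordinate at a time, for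
  indicators.  Adding \<open>w\<close> itself makes the weight \<open>w * cos Y + w\<close> nonnegative.
\<close>

lemma (in finite_measure) trig_weights_imp_indicator_weights:
  fixes X X' :: "'i \<Rightarrow> 'a \<Rightarrow> real"
  assumes fin: "finite J" and K: "K \<subseteq> J"
    and X [measurable]: "\<And>j. j \<in> J \<Longrightarrow> X j \<in> borel_measurable M"
    and X' [measurable]: "\<And>j. j \<in> J \<Longrightarrow> X' j \<in> borel_measurable M"
    and B [measurable]: "\<And>j. j \<in> J \<Longrightarrow> B j \<in> sets borel"
    and trig: "\<And>c. (\<integral>x. cos (\<Sum>j\<in>J. c j * X j x) \<partial>M) = (\<integral>x. cos (\<Sum>j\<in>J. c j * X' j x) \<partial>M)"
      "\<And>c. (\<integral>x. sin (\<Sum>j\<in>J. c j * X j x) \<partial>M) = (\<integral>x. sin (\<Sum>j\<in>J. c j * X' j x) \<partial>M)"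
  shows "(\<integral>x. (\<Prod>j\<in>K. indicator (B j) (X j x)) * cos (\<Sum>j\<in>J. c j * X j x) \<partial>M)
       = (\<integral>x. (\<Prod>j\<in>K. indicator (B j) (X' j x)) * cos (\<Sum>j\<in>J. c j * X' j x) \<partial>M) \<and>
    (\<integral>x. (\<Prod>j\<in>K. indicator (B j) (X j x)) * sin (\<Sum>j\<in>J. c j * X j x) \<partial>M)
       = (\<integral>x. (\<Prod>j\<in>K. indicator (B j) (X' j x)) * sin (\<Sum>j\<in>J. c j * X' j x) \<partial>M)"
  using finite_subset[OF K fin] K
\<comment> \<open>The coefficients must vary because the induction hypothesis is used at shifted
  values of \<open>c\<close>.\<close>
proof (induction K arbitrary: c rule: finite_induct)
  case empty
  show ?case by (simp add: trig)
next
  case (insert k K)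
  then have k: "k \<in> J" and KJ: "K \<subseteq> J" by auto
  define w where "w Z x = (\<Prod>j\<in>K. indicator (B j) (Z j x) :: real)" for Z :: "'i \<Rightarrow> 'a \<Rightarrow> real" and x
  define Y where "Y Z c x = (\<Sum>j\<in>J. c j * Z j x)" for Z :: "'i \<Rightarrow> 'a \<Rightarrow> real" and c x
  define V where "V Z \<longleftrightarrow> (\<forall>j\<in>J. Z j \<in> borel_measurable M)" for Z :: "'i \<Rightarrow> 'a \<Rightarrow> real"
  have V: "V X" "V X'" using X X' by (auto simp: V_def)
  have wm: "w Z \<in> borel_measurable M" if Z: "V Z" for Z
  proof -
    have [measurable]: "j \<in> K \<Longrightarrow> Z j \<in> borel_measurable M" "j \<in> K \<Longrightarrow> B j \<in> sets borel" for j
      using KJ Z B by (auto simp: V_def)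
    show ?thesis unfolding w_def by measurable
  qed
  have Ym: "Y Z c \<in> borel_measurable M" if Z: "V Z" for Z c
    using Z unfolding V_def Y_def by (intro borel_measurable_sum) auto
  have w01: "0 \<le> w Z x" "w Z x \<le> 1" for Z x
    unfolding w_def by (auto intro!: prod_nonneg prod_le_1 split: split_indicator)
  have wint: "integrable M (w Z)" if Z: "V Z" for Z
    by (rule integrable_const_bound[of _ 1]) (use w01 wm[OF that] in auto)
  have IHc: "(\<integral>x. w X x * cos (Y X d x) \<partial>M) = (\<integral>x. w X' x * cos (Y X' d x) \<partial>M)"
    and IHs: "(\<integral>x. w X x * sin (Y X d x) \<partial>M) = (\<integral>x. w X' x * sin (Y X' d x) \<partial>M)" for d
    using insert.IH[OF KJ, of d] by (simp_all add: w_def Y_def)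
  have add: "Y Z (\<lambda>j. c j + (if j = k then t else 0)) x = Y Z c x + t * Z k x" for Z c t x
  proof -
    have "(\<Sum>j\<in>J. (c j + (if j = k then t else 0)) * Z j x)
      = (\<Sum>j\<in>J. c j * Z j x + (if j = k then t * Z j x else 0))"
      by (intro sum.cong) (auto simp: algebra_simps)
    also have "\<dots> = (\<Sum>j\<in>J. c j * Z j x) + t * Z k x"
      using fin k by (simp add: sum.distrib)
    finally show ?thesis by (simp add: Y_def)
  qed
  have zero: "Y Z (\<lambda>_. 0) x = 0" for Z x by (simp add: Y_def)
  \<comment> \<open>\<open>p t\<close> shifts the coefficient of \<open>k\<close> in
    \<open>c\<close> by \<open>t\<close>, and \<open>q t\<close> has \<open>t\<close> at
    \<open>k\<close> as its only coefficient. The product-to-sum formulas then express a product of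
    one trigonometric factor in \<open>Y Z c\<close> and one in \<open>t * Z k\<close> through
    \<open>Y Z (p t)\<close> and \<open>Y Z (p (-t))\<close>, where the induction hypothesis is
    available.\<close>
  define p where "p t = (\<lambda>j. c j + (if j = k then t else 0))" for t
  define q where "q t = (\<lambda>j::'i. 0 + (if j = k then t else 0 :: real))" for t
  have p: "Y Z (p t) x = Y Z c x + t * Z k x" for Z t x using add by (simp add: p_def)
  have q: "Y Z (q t) x = t * Z k x" for Z t x using add[of Z "\<lambda>_. 0"] zero by (simp add: q_def)
  have int: "integrable M (\<lambda>x. w Z x * cos (Y Z d x))" "integrable M (\<lambda>x. w Z x * sin (Y Z d x))"
    if Z: "V Z" for Z d
    by (rule integrable_weighted_bounded; use wint[OF that] Ym[OF that] in auto)+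
  have half_add: "(\<integral>x. h x \<partial>M) = ((\<integral>x. f x \<partial>M) + (\<integral>x. g x \<partial>M)) / 2"
    if "integrable M f" "integrable M g" "\<And>x. h x = (f x + g x) / 2" for f g h :: "'a \<Rightarrow> real"
    unfolding that(3) using that(1,2) by simp
  have half_diff: "(\<integral>x. h x \<partial>M) = ((\<integral>x. f x \<partial>M) - (\<integral>x. g x \<partial>M)) / 2"
    if "integrable M f" "integrable M g" "\<And>x. h x = (f x - g x) / 2" for f g h :: "'a \<Rightarrow> real"
    unfolding that(3) using that(1,2) by simp
  have cc: "(\<integral>x. w Z x * cos (Y Z c x) * cos (t * Z k x) \<partial>M) =
      ((\<integral>x. w Z x * cos (Y Z (p t) x) \<partial>M) + (\<integral>x. w Z x * cos (Y Z (p (-t)) x) \<partial>M)) / 2"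
    if Z: "V Z" for Z t
    by (rule half_add[OF int(1)[OF Z] int(1)[OF Z]])
      (simp_all add: p cos_add sin_add cos_diff sin_diff algebra_simps)
  have cs: "(\<integral>x. w Z x * cos (Y Z c x) * sin (t * Z k x) \<partial>M) =
      ((\<integral>x. w Z x * sin (Y Z (p t) x) \<partial>M) - (\<integral>x. w Z x * sin (Y Z (p (-t)) x) \<partial>M)) / 2"
    if Z: "V Z" for Z t
    by (rule half_diff[OF int(2)[OF Z] int(2)[OF Z]])
      (simp_all add: p cos_add sin_add cos_diff sin_diff algebra_simps)
  have sc: "(\<integral>x. w Z x * sin (Y Z c x) * cos (t * Z k x) \<partial>M) =
      ((\<integral>x. w Z x * sin (Y Z (p t) x) \<partial>M) + (\<integral>x. w Z x * sin (Y Z (p (-t)) x) \<partial>M)) / 2"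
    if Z: "V Z" for Z t
    by (rule half_add[OF int(2)[OF Z] int(2)[OF Z]])
      (simp_all add: p cos_add sin_add cos_diff sin_diff algebra_simps)
  have ss: "(\<integral>x. w Z x * sin (Y Z c x) * sin (t * Z k x) \<partial>M) =
      ((\<integral>x. w Z x * cos (Y Z (p (-t)) x) \<partial>M) - (\<integral>x. w Z x * cos (Y Z (p t) x) \<partial>M)) / 2"
    if Z: "V Z" for Z t
    by (rule half_diff[OF int(1)[OF Z] int(1)[OF Z]])
      (simp_all add: p cos_add sin_add cos_diff sin_diff algebra_simps)
  define I where "I Z x = (indicator (B k) (Z k x) :: real)" for Z :: "'i \<Rightarrow> 'a \<Rightarrow> real" and x
  have Im: "I Z \<in> borel_measurable M" if Z: "V Z" for Z
  proof -
    have [measurable]: "Z k \<in> borel_measurable M" "B k \<in> sets borel" using Z k B by (auto simp: V_def)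
    show ?thesis unfolding I_def by measurable
  qed
  \<comment> \<open>Here \<open>h\<close> is \<open>cos\<close> or \<open>sin\<close>, so the weight
    is signed. One-dimensional uniqueness is applied to the nonnegative weights \<open>w\<close> and
    \<open>w + w * h\<close>, and the two identities are subtracted.\<close>
  have trade: "(\<integral>x. w X x * h (Y X c x) * I X x \<partial>M) = (\<integral>x. w X' x * h (Y X' c x) * I X' x \<partial>M)"
    if h [measurable]: "h \<in> borel_measurable borel" and hb: "\<And>y. \<bar>h y :: real\<bar> \<le> 1"
      and hc: "\<And>t. (\<integral>x. w X x * h (Y X c x) * cos (t * X k x) \<partial>M) = (\<integral>x. w X' x * h (Y X' c x) * cos (t * X' k x) \<partial>M)"
      and hs: "\<And>t. (\<integral>x. w X x * h (Y X c x) * sin (t * X k x) \<partial>M) = (\<integral>x. w X' x * h (Y X' c x) * sin (t * X' k x) \<partial>M)"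
    for h
  proof -
    have i1: "integrable M (\<lambda>x. w Z x * h (Y Z c x))" if Z: "V Z" for Z
      by (rule integrable_weighted_bounded) (use wint[OF Z] Ym[OF Z] hb in auto)
    have i2: "integrable M (\<lambda>x. w Z x * h (Y Z c x) * cos (t * Z k x))"
      "integrable M (\<lambda>x. w Z x * h (Y Z c x) * sin (t * Z k x))"
      "integrable M (\<lambda>x. w Z x * cos (t * Z k x))" "integrable M (\<lambda>x. w Z x * sin (t * Z k x))"
      "integrable M (\<lambda>x. w Z x * I Z x)" "integrable M (\<lambda>x. w Z x * h (Y Z c x) * I Z x)"
      if Z: "V Z" for Z t
    proof -
      have [measurable]: "Z k \<in> borel_measurable M" "I Z \<in> borel_measurable M"
        using Z k Im by (auto simp: V_def)
      have [simp]: "integrable M (w Z)" "integrable M (\<lambda>x. w Z x * h (Y Z c x))"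
        using Z wint i1 by auto
      have [simp]: "\<bar>I Z x\<bar> \<le> 1" for x by (simp add: I_def)
      show "integrable M (\<lambda>x. w Z x * h (Y Z c x) * cos (t * Z k x))"
      "integrable M (\<lambda>x. w Z x * h (Y Z c x) * sin (t * Z k x))"
      "integrable M (\<lambda>x. w Z x * cos (t * Z k x))" "integrable M (\<lambda>x. w Z x * sin (t * Z k x))"
      "integrable M (\<lambda>x. w Z x * I Z x)" "integrable M (\<lambda>x. w Z x * h (Y Z c x) * I Z x)"
        by (rule integrable_weighted_bounded; simp)+
    qed
    have nn: "0 \<le> w Z x + w Z x * h y" for Z x y
    proof -
      have "w Z x + w Z x * h y = w Z x * (1 + h y)" by (simp add: algebra_simps)
      moreover have "0 \<le> 1 + h y" using hb[of y] by linarith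
      ultimately show ?thesis using w01[of Z x] by simp
    qed
    have one: "(\<integral>x. w X x * I X x \<partial>M) = (\<integral>x. w X' x * I X' x \<partial>M)"
      unfolding I_def
    proof (rule weighted_law_unique)
      show "(\<integral>x. w X x * cos (t * X k x) \<partial>M) = (\<integral>x. w X' x * cos (t * X' k x) \<partial>M)" for t
        using IHc[of "q t"] by (simp add: q)
      show "(\<integral>x. w X x * sin (t * X k x) \<partial>M) = (\<integral>x. w X' x * sin (t * X' k x) \<partial>M)" for t
        using IHs[of "q t"] by (simp add: q)
    qed (use k X X' B wint w01 V in auto)
    have "(\<integral>x. (w X x + w X x * h (Y X c x)) * I X x \<partial>M) = (\<integral>x. (w X' x + w X' x * h (Y X' c x)) * I X' x \<partial>M)"
      unfolding I_def
    proof (rule weighted_law_unique)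
      show "(\<integral>x. (w X x + w X x * h (Y X c x)) * cos (t * X k x) \<partial>M)
        = (\<integral>x. (w X' x + w X' x * h (Y X' c x)) * cos (t * X' k x) \<partial>M)" for t
        using IHc[of "q t"] hc[of t] i2[OF V(1)] i2[OF V(2)] by (simp add: q distrib_right)
      show "(\<integral>x. (w X x + w X x * h (Y X c x)) * sin (t * X k x) \<partial>M)
        = (\<integral>x. (w X' x + w X' x * h (Y X' c x)) * sin (t * X' k x) \<partial>M)" for t
        using IHs[of "q t"] hs[of t] i2[OF V(1)] i2[OF V(2)] by (simp add: q distrib_right)
    qed (use k X X' B wint i1 nn V in auto)
    then show ?thesis
      using one i2[OF V(1)] i2[OF V(2)] by (simp add: distrib_right)
  qed
  have "(\<integral>x. w X x * cos (Y X c x) * I X x \<partial>M) = (\<integral>x. w X' x * cos (Y X' c x) * I X' x \<partial>M)"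
    by (rule trade) (simp_all add: cc[OF V(1)] cc[OF V(2)] cs[OF V(1)] cs[OF V(2)] IHc IHs)
  moreover have "(\<integral>x. w X x * sin (Y X c x) * I X x \<partial>M) = (\<integral>x. w X' x * sin (Y X' c x) * I X' x \<partial>M)"
    by (rule trade) (simp_all add: sc[OF V(1)] sc[OF V(2)] ss[OF V(1)] ss[OF V(2)] IHc IHs)
  ultimately show ?case
    using insert.hyps by (simp add: w_def Y_def I_def mult_ac)
qed

text \<open>The second moment of a linear combination is a quadratic form in the covariances, so
  corresponding combinations of the two families have the same normal law. Their trigonometric
  moments agree, hence so do the probabilities of cylinders over finite index sets, and these
  determine a finite measure on the product.\<close>

lemma (in prob_space) centered_gaussian_family_law_eq:
  fixes X X' :: "'i \<Rightarrow> 'a \<Rightarrow> real"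
  assumes X: "centered_gaussian_family M I X" and X': "centered_gaussian_family M I X'"
    and cov: "\<And>i j. i \<in> I \<Longrightarrow> j \<in> I \<Longrightarrow> (\<integral>x. X i x * X j x \<partial>M) = (\<integral>x. X' i x * X' j x \<partial>M)"
  shows "family_law M I X = family_law M I X'"
proof -
  have lin: "centered_normal M (\<lambda>x. \<Sum>j\<in>J. c j * Z j x)"
    if "centered_gaussian_family M I Z" "finite J" "J \<subseteq> I" for Z J c
    using that by (simp add: centered_gaussian_family_def)
  have cn: "centered_normal M (Z i)" if "centered_gaussian_family M I Z" "i \<in> I" for Z i
    using lin[OF that(1), of "{i}" "\<lambda>_. 1"] that by simp
  have meas: "Z i \<in> borel_measurable M" if "centered_gaussian_family M I Z" "i \<in> I" for Z i
    using cn[OF that] by (simp add: centered_normal_def)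
  note [measurable] = meas[OF X] meas[OF X']
  have prod_int: "integrable M (\<lambda>x. Z i x * Z j x)"
    if "centered_gaussian_family M I Z" "i \<in> I" "j \<in> I" for Z i j
  proof (rule Bochner_Integration.integrable_bound)
    show "integrable M (\<lambda>x. (Z i x)\<^sup>2 + (Z j x)\<^sup>2)"
      using that by (intro Bochner_Integration.integrable_add centered_normal_sq_integrable cn)
    show "(\<lambda>x. Z i x * Z j x) \<in> borel_measurable M"
      using that meas by (intro borel_measurable_times) auto
    have "\<bar>a * b\<bar> \<le> a\<^sup>2 + b\<^sup>2" for a b :: real
      using sum_squares_bound[of "\<bar>a\<bar>" "\<bar>b\<bar>"] mult_nonneg_nonneg[of "\<bar>a\<bar>" "\<bar>b\<bar>"]
      by (simp add: abs_mult del: mult_nonneg_nonneg)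
    then show "AE x in M. norm (Z i x * Z j x) \<le> norm ((Z i x)\<^sup>2 + (Z j x)\<^sup>2)"
      by auto
  qed
  have second: "(\<integral>x. (\<Sum>j\<in>J. c j * Z j x)\<^sup>2 \<partial>M) = (\<Sum>i\<in>J. \<Sum>j\<in>J. c i * c j * (\<integral>x. Z i x * Z j x \<partial>M))"
    if Z: "centered_gaussian_family M I Z" "finite J" "J \<subseteq> I" for Z J c
  proof -
    have "(\<integral>x. (\<Sum>j\<in>J. c j * Z j x)\<^sup>2 \<partial>M) = (\<integral>x. (\<Sum>i\<in>J. \<Sum>j\<in>J. c i * c j * (Z i x * Z j x)) \<partial>M)"
      by (simp add: power2_eq_square sum_product mult_ac)
    also have "\<dots> = (\<Sum>i\<in>J. \<Sum>j\<in>J. c i * c j * (\<integral>x. Z i x * Z j x \<partial>M))"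
    proof -
      have "integrable M (\<lambda>x. c i * c j * (Z i x * Z j x))" if "i \<in> J" "j \<in> J" for i j
        using prod_int[OF Z(1), of i j] that Z(3) by auto
      then show ?thesis
        by (subst Bochner_Integration.integral_sum; (intro Bochner_Integration.integrable_sum)?; simp add: Bochner_Integration.integral_sum)
    qed
    finally show ?thesis .
  qed
  have g: "(\<integral>x. g (\<Sum>j\<in>J. c j * X j x) \<partial>M) = (\<integral>x. g (\<Sum>j\<in>J. c j * X' j x) \<partial>M)"
    if "finite J" "J \<subseteq> I" "g \<in> borel_measurable borel" for g :: "real \<Rightarrow> real" and J c
  proof (rule centered_normal_integral_eq[where X="\<lambda>x. \<Sum>j\<in>J. c j * X j x" and Y="\<lambda>x. \<Sum>j\<in>J. c j * X' j x" and g=g])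
    show "(\<integral>x. (\<Sum>j\<in>J. c j * X j x)\<^sup>2 \<partial>M) = (\<integral>x. (\<Sum>j\<in>J. c j * X' j x)\<^sup>2 \<partial>M)"
      unfolding second[OF X that(1,2)] second[OF X' that(1,2)]
      using that by (intro sum.cong refl arg_cong2[where f=times] cov) auto
  qed (use that X X' in \<open>auto intro: lin\<close>)
  have fm: "(\<lambda>\<omega>. \<lambda>i\<in>I. Z i \<omega>) \<in> M \<rightarrow>\<^sub>M Pi\<^sub>M I (\<lambda>_. borel)" if "centered_gaussian_family M I Z" for Z
    using meas[OF that] by (intro measurable_restrict)
  show ?thesis
    unfolding family_law_def
  proof (rule measure_eqI_PiM_infinite)
    show "finite_measure (distr M (Pi\<^sub>M I (\<lambda>_. borel)) (\<lambda>\<omega>. \<lambda>i\<in>I. X i \<omega>))"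
      using fm[OF X] by (rule finite_measure_distr)
    fix A :: "'i \<Rightarrow> real set" and J assume J: "finite J" "J \<subseteq> I" "\<And>i. i \<in> J \<Longrightarrow> A i \<in> sets borel"
    have em: "emeasure (distr M (Pi\<^sub>M I (\<lambda>_. borel)) (\<lambda>\<omega>. \<lambda>i\<in>I. Z i \<omega>)) (prod_emb I (\<lambda>_. borel) J (Pi\<^sub>E J A))
      = ennreal (\<integral>x. (\<Prod>j\<in>J. indicator (A j) (Z j x)) \<partial>M)" if Z: "centered_gaussian_family M I Z" for Z
    proof -
      define S where "S = (\<lambda>\<omega>. \<lambda>i\<in>I. Z i \<omega>) -` prod_emb I (\<lambda>_. borel) J (Pi\<^sub>E J A) \<inter> space M"
      have S: "S \<in> sets M"
        unfolding S_def using J by (intro measurable_sets[OF fm[OF Z]] sets_PiM_I) auto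
      have "indicator S x = (\<Prod>j\<in>J. indicator (A j) (Z j x) :: real)" if "x \<in> space M" for x
      proof -
        have "x \<in> S \<longleftrightarrow> (\<forall>j\<in>J. Z j x \<in> A j)"
          using that J(2) by (auto simp: S_def prod_emb_def restrict_def PiE_iff extensional_def)
        then show ?thesis
          using J(1) by (auto simp: indicator_def intro!: prod.neutral)
      qed
      then have "(\<integral>x. (\<Prod>j\<in>J. indicator (A j) (Z j x) :: real) \<partial>M) = (\<integral>x. indicator S x \<partial>M)"
        by (intro Bochner_Integration.integral_cong) auto
      also have "\<dots> = measure M S" using S by simp
      finally have *: "(\<integral>x. (\<Prod>j\<in>J. indicator (A j) (Z j x)) \<partial>M) = measure M S" .
      have "emeasure (distr M (Pi\<^sub>M I (\<lambda>_. borel)) (\<lambda>\<omega>. \<lambda>i\<in>I. Z i \<omega>)) (prod_emb I (\<lambda>_. borel) J (Pi\<^sub>E J A)) = emeasure M S"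
        unfolding S_def using J by (intro emeasure_distr fm[OF Z] sets_PiM_I) auto
      then show ?thesis by (simp add: emeasure_eq_measure *)
    qed
    \<comment> \<open>With all coefficients 0 the cosine factor is 1, and only the product of the
      indicators over all of \<open>J\<close> is left.\<close>
    have "(\<integral>x. (\<Prod>j\<in>J. indicator (A j) (X j x)) * cos (\<Sum>j\<in>J. 0 * X j x) \<partial>M)
        = (\<integral>x. (\<Prod>j\<in>J. indicator (A j) (X' j x)) * cos (\<Sum>j\<in>J. 0 * X' j x) \<partial>M)"
      by (rule conjunct1, rule trig_weights_imp_indicator_weights)
        (use J meas[OF X] meas[OF X'] in \<open>auto intro!: g\<close>)
    then show "emeasure (distr M (Pi\<^sub>M I (\<lambda>_. borel)) (\<lambda>\<omega>. \<lambda>i\<in>I. X i \<omega>)) (prod_emb I (\<lambda>_. borel) J (Pi\<^sub>E J A))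
      = emeasure (distr M (Pi\<^sub>M I (\<lambda>_. borel)) (\<lambda>\<omega>. \<lambda>i\<in>I. X' i \<omega>)) (prod_emb I (\<lambda>_. borel) J (Pi\<^sub>E J A))"
      by (simp add: em[OF X] em[OF X'])
  qed simp_all
qed

lemma centered_gaussian_family_reindex:
  assumes W: "centered_gaussian_family M I W" and g: "inj_on g I" "g ` I \<subseteq> I"
  shows "centered_gaussian_family M I (\<lambda>i. W (g i))"
  unfolding centered_gaussian_family_def
proof (intro allI impI)
  fix J c assume J: "finite J" "J \<subseteq> I"
  have inj: "inj_on g J" using g(1) J(2) by (rule inj_on_subset)
  have "(\<lambda>\<omega>. \<Sum>j\<in>J. c j * W (g j) \<omega>) = (\<lambda>\<omega>. \<Sum>k\<in>g ` J. c (the_inv_into J g k) * W k \<omega>)"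
    using inj by (simp add: sum.reindex the_inv_into_f_f)
  moreover have "finite (g ` J)" "g ` J \<subseteq> I" using J g(2) by auto
  then have "centered_normal M (\<lambda>\<omega>. \<Sum>k\<in>g ` J. c (the_inv_into J g k) * W k \<omega>)"
    using W[unfolded centered_gaussian_family_def, rule_format, of "g ` J" "\<lambda>k. c (the_inv_into J g k)"] by simp
  ultimately show "centered_normal M (\<lambda>\<omega>. \<Sum>j\<in>J. c j * W (g j) \<omega>)" by simp
qed

section \<open>Completeness of the space of square integrable functions\<close>

lemma L2_eq_iff:
  assumes "sq_integrable f" "sq_integrable g"
  shows "abs_L2 f = abs_L2 g \<longleftrightarrow> (AE x in lborel. f x = g x)"
  using Quotient3_rel_abs[OF Quotient3_L2] Quotient3_rel[OF Quotient3_L2, of f g] assms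
  by (auto simp: L2_rel_def)

lemma sq_integrable_rep_L2: "sq_integrable (rep_L2 u)"
  using Quotient3_rep_reflp[OF Quotient3_L2, of u] by (simp add: L2_rel_def)

lemma abs_rep_L2 [simp]: "abs_L2 (rep_L2 u) = u"
  by (rule Quotient3_abs_rep[OF Quotient3_L2])

lemma rep_abs_L2: "sq_integrable f \<Longrightarrow> AE x in lborel. rep_L2 (abs_L2 f) x = f x"
  using L2_eq_iff[OF sq_integrable_rep_L2, of f "abs_L2 f"] by simp

lemma abs_L2_add: "sq_integrable f \<Longrightarrow> sq_integrable g \<Longrightarrow> abs_L2 f + abs_L2 g = abs_L2 (\<lambda>x. f x + g x)"
  by (intro plus_L2.abs_eq) (simp_all add: L2_rel_def)

lemma abs_L2_scale: "sq_integrable f \<Longrightarrow> c *\<^sub>R abs_L2 f = abs_L2 (\<lambda>x. c * f x)"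
  by (intro scaleR_L2.abs_eq) (simp_all add: L2_rel_def)

lemma abs_L2_inner:
  "sq_integrable f \<Longrightarrow> sq_integrable g \<Longrightarrow> inner (abs_L2 f) (abs_L2 g) = (\<integral>x. f x * g x \<partial>lborel)"
  by (intro inner_L2.abs_eq) (simp_all add: L2_rel_def)

lemma sq_integrable_diff:
  assumes "sq_integrable f" "sq_integrable g"
  shows "sq_integrable (\<lambda>x. f x - g x)"
  using sq_integrable_add[OF assms(1) sq_integrable_scale[OF assms(2), of "-1"]] by simp

lemma abs_L2_diff:
  assumes "sq_integrable f" "sq_integrable g"
  shows "abs_L2 f - abs_L2 g = abs_L2 (\<lambda>x. f x - g x)"
proof -
  have "abs_L2 f - abs_L2 g = abs_L2 f + (-1) *\<^sub>R abs_L2 g" by simp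
  also have "\<dots> = abs_L2 (\<lambda>x. f x + (-1) * g x)"
    using assms by (simp only: abs_L2_scale abs_L2_add sq_integrable_scale)
  finally show ?thesis by simp
qed

text \<open>The nonnegative integral allows Fatou's lemma to be applied before the limit is known to
  be square integrable.\<close>

lemma nn_integral_L2_diff:
  "(\<integral>\<^sup>+x. ennreal ((rep_L2 u x - rep_L2 v x)\<^sup>2) \<partial>lborel) = ennreal ((norm (u - v))\<^sup>2)"
proof -
  have d: "sq_integrable (\<lambda>x. rep_L2 u x - rep_L2 v x)"
    by (intro sq_integrable_diff sq_integrable_rep_L2)
  have "u - v = abs_L2 (\<lambda>x. rep_L2 u x - rep_L2 v x)"
    using abs_L2_diff[OF sq_integrable_rep_L2[of u] sq_integrable_rep_L2[of v]] by simp
  then have "(norm (u - v))\<^sup>2 = (\<integral>x. (rep_L2 u x - rep_L2 v x)\<^sup>2 \<partial>lborel)"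
    using abs_L2_inner[OF d d] by (simp only: power2_norm_eq_inner) (simp add: power2_eq_square)
  then show ?thesis
    using d by (simp add: nn_integral_eq_integral sq_integrable_def)
qed

text \<open>
  Riesz--Fischer.  For a fast Cauchy sequence the sum of \<open>2 ^ k * (f (k + 1) - f k)\<^sup>2\<close> is
  integrable, which bounds the increments pointwise by a geometric sequence and so gives
  almost everywhere convergence without Minkowski's inequality.
\<close>

lemma L2_fast_Cauchy_convergent:
  fixes u :: "nat \<Rightarrow> 'a::euclidean_space L2"
  assumes fast: "\<And>k m. k \<le> m \<Longrightarrow> norm (u m - u k) \<le> (1/2) ^ k"
  shows "convergent u"
proof -
  define f where "f k = rep_L2 (u k)" for k
  have f: "sq_integrable (f k)" for k unfolding f_def by (rule sq_integrable_rep_L2)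
  have [measurable]: "f k \<in> borel_measurable borel" for k using f[of k] by (simp add: sq_integrable_def)
  have nd: "(\<integral>\<^sup>+x. ennreal ((f m x - f k x)\<^sup>2) \<partial>lborel) \<le> ennreal (((1/2) ^ k)\<^sup>2)" if "k \<le> m" for k m
    unfolding f_def nn_integral_L2_diff using fast[OF that] by (intro ennreal_leI power_mono) auto
  have "(\<integral>\<^sup>+x. (\<Sum>k. ennreal (2 ^ k * (f (Suc k) x - f k x)\<^sup>2)) \<partial>lborel)
    = (\<Sum>k. ennreal (2 ^ k) * (\<integral>\<^sup>+x. ennreal ((f (Suc k) x - f k x)\<^sup>2) \<partial>lborel))"
    by (subst nn_integral_suminf) (auto simp: ennreal_mult nn_integral_cmult)
  also have "\<dots> \<le> (\<Sum>k. ennreal ((1/2) ^ k))"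
  proof (intro suminf_le summableI allI)
    fix k :: nat
    have "ennreal (2 ^ k) * (\<integral>\<^sup>+x. ennreal ((f (Suc k) x - f k x)\<^sup>2) \<partial>lborel) \<le> ennreal (2 ^ k) * ennreal (((1/2) ^ k)\<^sup>2)"
      using nd[of k "Suc k"] by (intro mult_left_mono) auto
    also have "\<dots> = ennreal ((1/2) ^ k)"
      by (simp add: ennreal_mult[symmetric] power2_eq_square power_mult_distrib[symmetric])
    finally show "ennreal (2 ^ k) * (\<integral>\<^sup>+x. ennreal ((f (Suc k) x - f k x)\<^sup>2) \<partial>lborel) \<le> ennreal ((1/2) ^ k)" .
  qed
  also have "\<dots> = ennreal (\<Sum>k. (1/2) ^ k)"
    by (intro suminf_ennreal2 summable_geometric) auto
  finally have "(\<integral>\<^sup>+x. (\<Sum>k. ennreal (2 ^ k * (f (Suc k) x - f k x)\<^sup>2)) \<partial>lborel) \<noteq> \<infinity>"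
    by (auto simp: top_unique)
  then have "AE x in lborel. (\<Sum>k. ennreal (2 ^ k * (f (Suc k) x - f k x)\<^sup>2)) \<noteq> \<infinity>"
    by (intro nn_integral_noteq_infinite) auto
  then have conv: "AE x in lborel. convergent (\<lambda>k. f k x)"
  proof eventually_elim
    case (elim x)
    define d where "d k = f (Suc k) x - f k x" for k
    have "summable (\<lambda>k. 2 ^ k * (d k)\<^sup>2)"
      using elim by (intro summable_suminf_not_top) (auto simp: d_def)
    then have "summable (\<lambda>k. (1/2) ^ k + 2 ^ k * (d k)\<^sup>2)"
      by (intro summable_add summable_geometric) auto
    then have "summable (\<lambda>k. norm (d k))"
    proof (rule summable_comparison_test_ev[rotated], intro always_eventually allI)
      fix k
      have "\<bar>d k\<bar> \<le> (1/2) ^ k + 2 ^ k * (d k)\<^sup>2"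
      \<comment> \<open>Increments of size at most \<open>2 ^ (- k)\<close> are absorbed by the
        geometric term; for a larger one, multiplying by \<open>2 ^ k * \<bar>d k\<bar>\<close>,
        which exceeds 1, gives the quadratic term.\<close>
      proof (cases "2 ^ k * \<bar>d k\<bar> \<le> 1")
        case True
        then have "\<bar>d k\<bar> \<le> (1/2) ^ k" by (simp add: power_one_over field_simps)
        then show ?thesis by (simp add: add_increasing2)
      next
        case False
        then have "1 * \<bar>d k\<bar> \<le> (2 ^ k * \<bar>d k\<bar>) * \<bar>d k\<bar>" by (intro mult_right_mono) auto
        then have "\<bar>d k\<bar> \<le> 2 ^ k * (d k)\<^sup>2" by (simp add: power2_eq_square mult.assoc)
        then show ?thesis by (simp add: add_increasing)
      qed
      then show "norm (norm (d k)) \<le> (1/2) ^ k + 2 ^ k * (d k)\<^sup>2" by simp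
    qed
    then have "summable d" by (rule summable_norm_cancel)
    then have "(\<lambda>n. \<Sum>k<n. d k) \<longlonglongrightarrow> suminf d" by (rule summable_LIMSEQ)
    moreover have "(\<Sum>k<n. d k) = f n x - f 0 x" for n
      unfolding d_def by (rule sum_lessThan_telescope)
    ultimately have "(\<lambda>n. f n x - f 0 x + f 0 x) \<longlonglongrightarrow> suminf d + f 0 x"
      by (intro tendsto_add) auto
    then show ?case by (auto simp: convergent_def)
  qed
  define g where "g x = lim (\<lambda>k. f k x)" for x
  have gm [measurable]: "g \<in> borel_measurable borel" unfolding g_def by measurable
  \<comment> \<open>Fatou's lemma in \<open>m\<close> with \<open>k\<close> fixed. The case
    \<open>k = 0\<close> makes \<open>g\<close> square integrable, and general \<open>k\<close>
    gives the rate of convergence in norm.\<close>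
  have gd: "(\<integral>\<^sup>+x. ennreal ((g x - f k x)\<^sup>2) \<partial>lborel) \<le> ennreal (((1/2) ^ k)\<^sup>2)" for k
  proof -
    have "(\<integral>\<^sup>+x. ennreal ((g x - f k x)\<^sup>2) \<partial>lborel)
      = (\<integral>\<^sup>+x. liminf (\<lambda>m. ennreal ((f m x - f k x)\<^sup>2)) \<partial>lborel)"
    proof (rule nn_integral_cong_AE, use conv in eventually_elim)
      case (elim x)
      then have "(\<lambda>m. f m x) \<longlonglongrightarrow> g x" by (simp add: g_def convergent_LIMSEQ_iff)
      then have "(\<lambda>m. ennreal ((f m x - f k x)\<^sup>2)) \<longlonglongrightarrow> ennreal ((g x - f k x)\<^sup>2)"
        by (intro tendsto_intros)
      from lim_imp_Liminf[OF _ this] show ?case by simp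
    qed
    also have "\<dots> \<le> liminf (\<lambda>m. \<integral>\<^sup>+x. ennreal ((f m x - f k x)\<^sup>2) \<partial>lborel)"
      by (rule nn_integral_liminf) auto
    also have "\<dots> \<le> ennreal (((1/2) ^ k)\<^sup>2)"
    proof -
      have "liminf (\<lambda>m. \<integral>\<^sup>+x. ennreal ((f m x - f k x)\<^sup>2) \<partial>lborel) \<le> liminf (\<lambda>m. ennreal (((1/2) ^ k)\<^sup>2))"
        by (intro Liminf_mono eventually_sequentiallyI[of k] nd)
      then show ?thesis by (simp add: Liminf_const)
    qed
    finally show ?thesis .
  qed
  have gs: "sq_integrable g"
  proof -
    have "sq_integrable (\<lambda>x. g x - f 0 x)"
      unfolding sq_integrable_def
    proof
      have "(\<integral>\<^sup>+x. ennreal ((g x - f 0 x)\<^sup>2) \<partial>lborel) < \<infinity>"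
        using gd[of 0] by (rule le_less_trans) simp
      then show "integrable lborel (\<lambda>x. (g x - f 0 x)\<^sup>2)"
        by (intro integrableI_bounded) auto
    qed simp
    from sq_integrable_add[OF this f[of 0]] show ?thesis by simp
  qed
  have "norm (abs_L2 g - u k) \<le> (1/2) ^ k" for k
  proof -
    have "ennreal ((norm (abs_L2 g - u k))\<^sup>2) = (\<integral>\<^sup>+x. ennreal ((g x - f k x)\<^sup>2) \<partial>lborel)"
      unfolding nn_integral_L2_diff[symmetric] f_def
      by (rule nn_integral_cong_AE, use rep_abs_L2[OF gs] in eventually_elim) simp
    with gd[of k] have "ennreal ((norm (abs_L2 g - u k))\<^sup>2) \<le> ennreal (((1/2) ^ k)\<^sup>2)" by simp
    then have "(norm (abs_L2 g - u k))\<^sup>2 \<le> ((1/2) ^ k)\<^sup>2" by (subst (asm) ennreal_le_iff) auto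
    then show ?thesis by (rule power2_le_imp_le) simp
  qed
  then have "norm (u k - abs_L2 g) \<le> (1/2) ^ k" for k by (metis norm_minus_commute)
  then have "\<forall>\<^sub>F k in sequentially. norm (u k - abs_L2 g) \<le> (1/2) ^ k"
    by (intro always_eventually allI)
  then have "(\<lambda>k. u k - abs_L2 g) \<longlonglongrightarrow> 0"
    by (rule Lim_null_comparison) (rule LIMSEQ_power_zero, simp)
  then have "u \<longlonglongrightarrow> abs_L2 g" by (rule LIM_zero_cancel)
  then show ?thesis by (rule convergentI)
qed

instance L2 :: (euclidean_space) banach
proof
  fix u :: "nat \<Rightarrow> 'a L2"
  assume u: "Cauchy u"
  have "\<exists>N. \<forall>k\<ge>N. \<forall>m\<ge>N. dist (u k) (u m) < (1/2) ^ j" for j :: nat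
    using metric_CauchyD[OF u, of "(1/2) ^ j"] by auto
  then obtain N where N: "\<And>j k m. k \<ge> N j \<Longrightarrow> m \<ge> N j \<Longrightarrow> dist (u k) (u m) < (1/2) ^ j"
    by metis
  \<comment> \<open>Summing all earlier thresholds makes \<open>s j\<close> at least
    \<open>N j\<close>; the extra \<open>j\<close> makes \<open>s\<close> strictly increasing even
    where \<open>N\<close> vanishes.\<close>
  define s where "s j = (\<Sum>i\<le>j. N i) + j" for j
  have s: "N j \<le> s j" for j
    unfolding s_def by (metis atMost_iff finite_atMost le_add1 le_refl le_trans member_le_sum zero_le)
  have mono: "strict_mono s" by (rule strict_monoI_Suc) (simp add: s_def)
  have "convergent (u \<circ> s)"
  proof (rule L2_fast_Cauchy_convergent)
    fix k m :: nat assume "k \<le> m"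
    then have "s k \<le> s m" using mono by (simp add: strict_mono_less_eq)
    then show "norm ((u \<circ> s) m - (u \<circ> s) k) \<le> (1/2) ^ k"
      using N[of k "s m" "s k"] s[of k] by (simp add: dist_norm)
  qed
  then obtain l where "(u \<circ> s) \<longlonglongrightarrow> l" by (auto simp: convergent_def)
  then show "convergent u"
    using Cauchy_converges_subseq[OF u mono] by (auto simp: convergent_def)
qed

section \<open>Uniqueness of spectral resolutions\<close>

text \<open>The setwise bound passes to simple functions by linearity and to all measurable
  functions by monotone limits. It serves to bound the spectral measure of a sum of vectors.\<close>

lemma nn_integral_le_add_measure:
  assumes sets: "sets N1 = sets N2" "sets N1 = sets N3"
    and le: "\<And>A. A \<in> sets N1 \<Longrightarrow> emeasure N1 A \<le> emeasure N2 A + emeasure N3 A"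
    and f: "f \<in> borel_measurable N1"
  shows "(\<integral>\<^sup>+x. f x \<partial>N1) \<le> (\<integral>\<^sup>+x. f x \<partial>N2) + (\<integral>\<^sup>+x. f x \<partial>N3)"
proof -
  have meas: "h \<in> borel_measurable N" if "h \<in> borel_measurable N1" "sets N = sets N1"
    for h :: "_ \<Rightarrow> ennreal" and N
    using that measurable_cong_sets[of N N1 borel borel] by blast
  show ?thesis
    using f
  proof (induction f rule: borel_measurable_induct)
    case (cong f g)
    have "space N2 = space N1" "space N3 = space N1"
      using sets by (metis sets_eq_imp_space_eq)+
    then have "(\<integral>\<^sup>+x. f x \<partial>N) = (\<integral>\<^sup>+x. g x \<partial>N)" if "N = N1 \<or> N = N2 \<or> N = N3" for N
      using that cong.hyps(3) by (intro nn_integral_cong) auto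
    with cong.IH show ?case by simp
  next
    case (set A)
    then show ?case using le sets by simp
  next
    case (mult u c)
    have "(\<integral>\<^sup>+x. c * u x \<partial>N) = c * (\<integral>\<^sup>+x. u x \<partial>N)" if "sets N = sets N1" for N
      by (intro nn_integral_cmult meas[OF _ that] mult.hyps)
    then show ?case
      using mult_left_mono[OF mult.IH, of c] sets by (simp add: distrib_left)
  next
    case (add u v)
    have "(\<integral>\<^sup>+x. v x + u x \<partial>N) = (\<integral>\<^sup>+x. v x \<partial>N) + (\<integral>\<^sup>+x. u x \<partial>N)" if "sets N = sets N1" for N
      by (intro nn_integral_add meas[OF _ that] add.hyps)
    then show ?case using add_mono[OF add.IH(2) add.IH(1)] sets by (simp add: add_ac)
  next
    case (seq U)
    have mono: "(\<integral>\<^sup>+x. U i x \<partial>N) \<le> (\<integral>\<^sup>+x. (SUP i. U i) x \<partial>N)" for i N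
      by (intro nn_integral_mono) (auto intro: SUP_upper le_funD)
    have "(\<integral>\<^sup>+x. (SUP i. U i) x \<partial>N1) = (SUP i. \<integral>\<^sup>+x. U i x \<partial>N1)"
      unfolding SUP_apply using seq.hyps by (intro nn_integral_monotone_convergence_SUP) auto
    also have "\<dots> \<le> (\<integral>\<^sup>+x. (SUP i. U i) x \<partial>N2) + (\<integral>\<^sup>+x. (SUP i. U i) x \<partial>N3)"
      by (intro SUP_least order_trans[OF seq.IH] add_mono mono)
    finally show ?case .
  qed
qed

section \<open>Signed binary expansions\<close>

text \<open>The remainder after \<open>n\<close> digits, magnified by \<open>2 ^ n\<close>. Digits 1
  and -1 are used instead of 0 and 1 because the operator belonging to a digit is then
  \<open>2 *\<^sub>R E B u - u\<close>, which preserves norms and leads to sharp estimates.\<close>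

primrec digit_rem :: "nat \<Rightarrow> real \<Rightarrow> real" where
  "digit_rem 0 y = y"
| "digit_rem (Suc n) y = 2 * digit_rem n y - (if 0 \<le> digit_rem n y then 1 else - 1)"

lemma digit_rem_measurable [measurable]: "digit_rem n \<in> borel_measurable borel"
proof (induction n)
  case 0
  have "digit_rem 0 = (\<lambda>y. y)" by auto
  then show ?case by simp
next
  case (Suc n)
  have "digit_rem (Suc n) = (\<lambda>y. 2 * digit_rem n y - (if 0 \<le> digit_rem n y then 1 else - 1))" by auto
  with Suc show ?case by simp
qed

definition digit :: "nat \<Rightarrow> real \<Rightarrow> real" where
  "digit n y = (if 0 \<le> digit_rem n y then 1 else - 1)"

lemma digit_measurable [measurable]: "digit n \<in> borel_measurable borel"
  unfolding digit_def[abs_def] by measurable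

lemma abs_digit: "\<bar>digit n y\<bar> = 1"
  by (simp add: digit_def)

text \<open>The error after \<open>n\<close> digits is \<open>(1/2) ^ n * digit_rem n y\<close>, and
  the recursion maps the interval from -1 to 1 into itself.\<close>

lemma digit_sums:
  assumes "\<bar>y\<bar> \<le> 1"
  shows "(\<lambda>n. (1/2) ^ Suc n * digit n y) sums y"
proof -
  have r: "\<bar>digit_rem n y\<bar> \<le> 1" for n
    using assms by (induction n) (auto split: if_splits)
  have eq: "(\<Sum>k<n. (1/2) ^ Suc k * digit k y) = y - (1/2) ^ n * digit_rem n y" for n
    by (induction n) (simp_all add: digit_def field_simps)
  have "(\<lambda>n. (1/2) ^ n * digit_rem n y) \<longlonglongrightarrow> 0"
  proof (rule Lim_null_comparison[of _ "\<lambda>n. (1/2) ^ n"])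
    show "\<forall>\<^sub>F n in sequentially. norm ((1/2) ^ n * digit_rem n y) \<le> (1/2) ^ n"
      using r by (intro always_eventually allI) (simp add: abs_mult mult_left_le)
  qed (rule LIMSEQ_power_zero, simp)
  from tendsto_diff[OF tendsto_const this, of y] show ?thesis
    unfolding sums_def eq by simp
qed

section \<open>Calculus of a projection-valued measure\<close>

locale spectral_resolution =
  fixes E :: "real set \<Rightarrow> 'h::{real_inner, banach} \<Rightarrow> 'h"
  assumes pvm: "projection_valued_measure E"
begin

abbreviation mu where "mu \<equiv> spectral_measure E"

lemma linear: "B \<in> sets borel \<Longrightarrow> linear (E B)"
  and symmetric: "B \<in> sets borel \<Longrightarrow> inner (E B u) v = inner u (E B v)"
  and E_UNIV [simp]: "E UNIV u = u"
  and E_Int: "B \<in> sets borel \<Longrightarrow> C \<in> sets borel \<Longrightarrow> E (B \<inter> C) u = E B (E C u)"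
  and E_sums: "range A \<subseteq> sets borel \<Longrightarrow> disjoint_family A \<Longrightarrow> (\<lambda>i. E (A i) u) sums E (\<Union>i. A i) u"
  for A :: "nat \<Rightarrow> real set"
  using pvm by (simp_all add: projection_valued_measure_def)

lemma E_idem: "B \<in> sets borel \<Longrightarrow> E B (E B u) = E B u"
  using E_Int[of B B] by simp

lemma E_add: "B \<in> sets borel \<Longrightarrow> E B (u + v) = E B u + E B v"
  and E_diff: "B \<in> sets borel \<Longrightarrow> E B (u - v) = E B u - E B v"
  and E_scaleR: "B \<in> sets borel \<Longrightarrow> E B (c *\<^sub>R u) = c *\<^sub>R E B u"
  using linear by (simp_all add: linear_add linear_diff linear_scale)

lemma inner_E_self: "B \<in> sets borel \<Longrightarrow> inner (E B u) u = (norm (E B u))\<^sup>2"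
  using symmetric[of B "E B u" u] by (simp add: E_idem power2_norm_eq_inner inner_commute)

lemma norm_E_le:
  assumes "B \<in> sets borel"
  shows "norm (E B u) \<le> norm u"
proof -
  have "norm (E B u) * norm (E B u) \<le> norm (E B u) * norm u"
    using Cauchy_Schwarz_ineq2[of "E B u" u] inner_E_self[OF assms, of u] by (simp add: power2_eq_square)
  then show ?thesis
    by (cases "E B u = 0") (auto dest: mult_left_le_imp_le)
qed

text \<open>The constant sequence of empty sets is disjoint, and a constant series converges only if
  its term is 0.\<close>

lemma E_empty [simp]: "E {} u = 0"
proof -
  have "summable (\<lambda>i::nat. E {} u)"
    using E_sums[of "\<lambda>_. {}" u] by (auto simp: disjoint_family_on_def sums_iff)
  then show ?thesis by (simp add: summable_const_iff)
qed

lemma E_Un: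
  assumes "B \<in> sets borel" "C \<in> sets borel" "B \<inter> C = {}"
  shows "E (B \<union> C) u = E B u + E C u"
proof -
  have "(\<lambda>i. E (binaryset B C i) u) sums E (\<Union>i. binaryset B C i) u"
    using assms by (intro E_sums)
      (auto simp: range_binaryset_eq disjoint_family_on_def binaryset_def)
  moreover have "(\<lambda>i. E (binaryset B C i) u) sums (E B u + E C u)"
    by (rule binaryset_sums) simp
  ultimately show ?thesis by (simp add: UN_binaryset_eq sums_unique2)
qed

lemma E_Compl: "B \<in> sets borel \<Longrightarrow> E (- B) u = u - E B u"
  using E_Un[of B "- B" u] by (simp add: algebra_simps)

lemma sets_mu [simp, measurable_cong]: "sets (mu u) = sets borel"
  by (simp add: spectral_measure_def) (metis sets.sigma_sets_eq space_borel)

lemma space_mu [simp]: "space (mu u) = UNIV"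
  by (simp add: spectral_measure_def)

lemma emeasure_mu: 
  assumes "B \<in> sets borel"
  shows "emeasure (mu u) B = ennreal ((norm (E B u))\<^sup>2)"
proof -
  have "emeasure (mu u) B = ennreal (inner (E B u) u)"
  proof (rule emeasure_measure_of[OF spectral_measure_def])
    show "countably_additive (sets (mu u)) (\<lambda>B. ennreal (inner (E B u) u))"
    proof (rule countably_additiveI)
      fix A :: "nat \<Rightarrow> real set"
      assume A: "range A \<subseteq> sets (mu u)" "disjoint_family A"
      have "(\<lambda>i. inner (E (A i) u) u) sums inner (E (\<Union>i. A i) u) u"
        using A by (intro bounded_linear.sums[OF bounded_linear_inner_left] E_sums) auto
      moreover have "0 \<le> inner (E (A i) u) u" for i
        using A by (subst inner_E_self) auto
      ultimately show "(\<Sum>i. ennreal (inner (E (A i) u) u)) = ennreal (inner (E (\<Union>i. A i) u) u)"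
        by (simp add: suminf_ennreal2 sums_iff)
    qed
  qed (use assms in \<open>auto simp: positive_def\<close>)
  then show ?thesis by (simp add: inner_E_self assms)
qed

lemma finite_mu: "finite_measure (mu u)"
  by (rule finite_measureI) (simp add: emeasure_mu)

lemma measure_mu: "B \<in> sets borel \<Longrightarrow> measure (mu u) B = (norm (E B u))\<^sup>2"
  by (simp add: measure_def emeasure_mu)

lemma mu_eq_0_iff: "B \<in> sets borel \<Longrightarrow> emeasure (mu u) B = 0 \<longleftrightarrow> E B u = 0"
  by (simp add: emeasure_mu)

text \<open>Multiplicativity, \<open>E (B \<inter> C) = E B \<circ> E C\<close>, turns projection of
  a vector into restriction of its spectral measure to \<open>C\<close>.\<close>

lemma mu_E:
  assumes "C \<in> sets borel"
  shows "mu (E C u) = density (mu u) (\<lambda>x. ennreal (indicator C x))"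
proof (rule measure_eqI)
  fix B assume "B \<in> sets (mu (E C u))"
  then have B: "B \<in> sets borel" by simp
  have "(\<integral>\<^sup>+x. ennreal (indicator C x) * indicator B x \<partial>mu u) = (\<integral>\<^sup>+x. indicator (B \<inter> C) x \<partial>mu u)"
    by (intro nn_integral_cong) (auto split: split_indicator)
  then show "emeasure (mu (E C u)) B = emeasure (density (mu u) (\<lambda>x. ennreal (indicator C x))) B"
    using assms B by (simp add: emeasure_density emeasure_mu E_Int)
qed simp

lemma mu_scaleR: "mu (c *\<^sub>R u) = density (mu u) (\<lambda>_. ennreal (c\<^sup>2))"
proof (rule measure_eqI)
  fix B assume "B \<in> sets (mu (c *\<^sub>R u))"
  then show "emeasure (mu (c *\<^sub>R u)) B = emeasure (density (mu u) (\<lambda>_. ennreal (c\<^sup>2))) B"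
    by (simp add: emeasure_density_const emeasure_mu E_scaleR power_mult_distrib ennreal_mult)
qed simp

section \<open>Domains of spectral integrals\<close>

lemma domain_E:
  assumes "C \<in> sets borel" "f \<in> borel_measurable borel" "u \<in> spectral_domain E f"
  shows "E C u \<in> spectral_domain E f"
proof -
  have "integrable (mu u) (\<lambda>x. (f x)\<^sup>2 * indicator C x)"
    using assms by (intro integrable_real_mult_indicator) (auto simp: spectral_domain_def)
  then show ?thesis
    using assms
    by (simp add: spectral_domain_def mu_E integrable_density mult.commute del: ennreal_indicator)
qed

lemma domain_scaleR:
  assumes "f \<in> borel_measurable borel" "u \<in> spectral_domain E f"
  shows "c *\<^sub>R u \<in> spectral_domain E f"
  using assms by (simp add: spectral_domain_def mu_scaleR integrable_density)

text \<open>Cross terms prevent \<open>mu (u + w)\<close> from being bounded by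
  \<open>mu u + mu w\<close>. The estimate (a + b)^2 \<le> (2 a)^2 + (2 b)^2 repairs this, and the
  factor 2 is absorbed into the vectors so that the bound consists of spectral measures
  again.\<close>

lemma domain_add:
  assumes f [measurable]: "f \<in> borel_measurable borel"
    and u: "u \<in> spectral_domain E f" and w: "w \<in> spectral_domain E f"
  shows "u + w \<in> spectral_domain E f"
proof -
  have "(\<integral>\<^sup>+x. ennreal ((f x)\<^sup>2) \<partial>mu (u + w))
      \<le> (\<integral>\<^sup>+x. ennreal ((f x)\<^sup>2) \<partial>mu (2 *\<^sub>R u)) + (\<integral>\<^sup>+x. ennreal ((f x)\<^sup>2) \<partial>mu (2 *\<^sub>R w))"
  proof (rule nn_integral_le_add_measure)
    fix B assume "B \<in> sets (mu (u + w))"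
    then have B: "B \<in> sets borel" by simp
    have "(norm (E B u + E B w))\<^sup>2 \<le> (norm (E B u) + norm (E B w))\<^sup>2"
      by (intro power_mono norm_triangle_ineq) simp
    also have "\<dots> \<le> (2 * norm (E B u))\<^sup>2 + (2 * norm (E B w))\<^sup>2"
    proof -
      have four: "(2 * a)\<^sup>2 = 4 * a\<^sup>2" for a :: real by (simp add: power_mult_distrib)
      show ?thesis
        using sum_squares_bound[of "norm (E B u)" "norm (E B w)"]
        zero_le_power2[of "norm (E B u)"] zero_le_power2[of "norm (E B w)"]
        unfolding power2_sum four by argo
    qed
    finally show "emeasure (mu (u + w)) B \<le> emeasure (mu (2 *\<^sub>R u)) B + emeasure (mu (2 *\<^sub>R w)) B"
      using B by (simp add: emeasure_mu E_add E_scaleR ennreal_plus[symmetric] del: ennreal_plus)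
  qed auto
  also have "\<dots> < \<infinity>"
    using domain_scaleR[OF f u, of 2] domain_scaleR[OF f w, of 2]
    by (simp add: spectral_domain_def integrable_iff_bounded)
  finally show ?thesis
    by (simp add: spectral_domain_def integrable_iff_bounded)
qed

lemma domain_diff:
  assumes "f \<in> borel_measurable borel" "u \<in> spectral_domain E f" "w \<in> spectral_domain E f"
  shows "u - w \<in> spectral_domain E f"
  using domain_add[OF assms(1,2) domain_scaleR[OF assms(1,3), of "-1"]] by simp

text \<open>This supplies the test vectors: wherever \<open>f\<close> is bounded, the whole spectral
  subspace lies in the domain.\<close>

lemma domain_bounded:
  assumes [measurable]: "C \<in> sets borel" "f \<in> borel_measurable borel"
    and C: "\<And>x. x \<in> C \<Longrightarrow> \<bar>f x\<bar> \<le> K"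
  shows "E C u \<in> spectral_domain E f"
proof -
  interpret finite_measure "mu u" by (rule finite_mu)
  have "integrable (mu u) (\<lambda>x. indicator C x * (f x)\<^sup>2)"
  proof (rule integrable_const_bound[of _ "K\<^sup>2"])
    have "(f x)\<^sup>2 \<le> K\<^sup>2" if "x \<in> C" for x
      using power_mono[OF C[OF that] abs_ge_zero, of 2] by simp
    then show "AE x in mu u. norm (indicator C x * (f x)\<^sup>2) \<le> K\<^sup>2"
      by (auto simp: indicator_def)
  qed simp
  then show ?thesis
    by (simp add: spectral_domain_def mu_E integrable_density del: ennreal_indicator)
qed

lemma domain_integrable:
  assumes [measurable]: "f \<in> borel_measurable borel" and "u \<in> spectral_domain E f"
  shows "integrable (mu u) f"
proof -
  interpret finite_measure "mu u" by (rule finite_mu)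
  show ?thesis
    by (rule square_integrable_imp_integrable) (use assms(2) in \<open>simp_all add: spectral_domain_def\<close>)
qed

lemma integral_mu_E:
  fixes f :: "real \<Rightarrow> real"
  assumes "C \<in> sets borel" "f \<in> borel_measurable borel"
  shows "(\<integral>x. f x \<partial>mu (E C u)) = (\<integral>x. indicator C x * f x \<partial>mu u)"
  using assms
  by (simp add: mu_E integral_density del: ennreal_indicator)

lemma integral_mu_scaleR:
  fixes f :: "real \<Rightarrow> real"
  assumes "f \<in> borel_measurable borel"
  shows "(\<integral>x. f x \<partial>mu (c *\<^sub>R u)) = c\<^sup>2 * (\<integral>x. f x \<partial>mu u)"
  using assms by (simp add: mu_scaleR integral_density)

lemma integral_mu_split:
  assumes C: "C \<in> sets borel" and f: "f \<in> borel_measurable borel" and u: "u \<in> spectral_domain E f"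
  shows "(\<integral>x. f x \<partial>mu u) = (\<integral>x. f x \<partial>mu (E C u)) + (\<integral>x. f x \<partial>mu (E (- C) u))"
proof -
  have i: "integrable (mu u) (\<lambda>x. indicator D x * f x)" if "D \<in> sets borel" for D
    using that integrable_real_mult_indicator[OF _ domain_integrable[OF f u], of D]
    by (simp add: mult.commute)
  have "(\<integral>x. f x \<partial>mu u) = (\<integral>x. indicator C x * f x + indicator (- C) x * f x \<partial>mu u)"
    by (intro Bochner_Integration.integral_cong) (auto simp: indicator_def)
  also have "\<dots> = (\<integral>x. indicator C x * f x \<partial>mu u) + (\<integral>x. indicator (- C) x * f x \<partial>mu u)"
    using C by (intro Bochner_Integration.integral_add i) auto
  finally show ?thesis using C f by (simp add: integral_mu_E)
qed

text \<open>Vanishing of \<open>E B u\<close> means that \<open>B\<close> is a null set of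
  \<open>mu u\<close>, and null sets are closed under countable unions, disjoint or not.\<close>

lemma E_eq_0_exhaust:
  fixes C :: "nat \<Rightarrow> real set"
  assumes "\<And>n. C n \<in> sets borel" "\<And>n. E (C n) u = 0"
  shows "E (\<Union>n. C n) u = 0"
proof -
  have "emeasure (mu u) (\<Union>n. C n) = 0"
    using assms by (intro emeasure_UN_eq_0) (auto simp: mu_eq_0_iff)
  then show ?thesis using assms by (subst (asm) mu_eq_0_iff) auto
qed

section \<open>Spectral integrals for a fixed resolution\<close>

lemma spectral_integral_inner:
  assumes "(u, v) \<in> spectral_integral E f" "w \<in> spectral_domain E f"
  shows "inner v w = ((\<integral>x. f x \<partial>mu (u + w)) - (\<integral>x. f x \<partial>mu (u - w))) / 4"
  using assms unfolding spectral_integral_def by blast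

text \<open>Both values have the same inner product with every vector of the domain. The projections
  of \<open>v - v'\<close> to the sets where \<open>f\<close> is bounded by \<open>n\<close> lie in
  the domain, hence are 0, and these sets exhaust the line.\<close>

lemma spectral_integral_unique:
  assumes [measurable]: "f \<in> borel_measurable borel"
    and "(u, v) \<in> spectral_integral E f" "(u, v') \<in> spectral_integral E f"
  shows "v = v'"
proof -
  define C where "C n = {x. \<bar>f x\<bar> \<le> real n}" for n :: nat
  have [measurable]: "C n \<in> sets borel" for n unfolding C_def by measurable
  have "E (C n) (v - v') = 0" for n
  proof -
    have "E (C n) (v - v') \<in> spectral_domain E f"
      by (rule domain_bounded[of _ _ "real n"]) (auto simp: C_def)
    then have "inner (v - v') (E (C n) (v - v')) = 0"
      by (simp only: inner_diff_left spectral_integral_inner[OF assms(2)] spectral_integral_inner[OF assms(3)])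
    then show ?thesis
      using inner_E_self[of "C n" "v - v'"] by (simp add: inner_commute[of "v - v'"])
  qed
  then have "E (\<Union>n. C n) (v - v') = 0" by (intro E_eq_0_exhaust) auto
  moreover have "(\<Union>n. C n) = UNIV" by (auto simp: C_def intro: real_arch_simple)
  ultimately show ?thesis by simp
qed

text \<open>The test vector is \<open>E C u\<close>. On \<open>C\<close> the vectors
  \<open>u + E C u\<close> and \<open>u - E C u\<close> project to twice \<open>E C u\<close> and to
  0, while their parts on the complement agree and cancel; the factor 4 is the one in the
  polarization formula.\<close>

lemma spectral_integral_inner_E:
  assumes [measurable]: "f \<in> borel_measurable borel" "C \<in> sets borel"
    and uv: "(u, v) \<in> spectral_integral E f"
  shows "inner v (E C u) = (\<integral>x. indicator C x * f x \<partial>mu u)"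
proof -
  have u: "u \<in> spectral_domain E f" using uv by (simp add: spectral_integral_def)
  have w: "E C u \<in> spectral_domain E f" by (rule domain_E) (use u in auto)
  have "(\<integral>x. f x \<partial>mu (u + E C u)) = (\<integral>x. f x \<partial>mu (E C (u + E C u))) + (\<integral>x. f x \<partial>mu (E (- C) (u + E C u)))"
    by (intro integral_mu_split domain_add u w) auto
  moreover have "(\<integral>x. f x \<partial>mu (u - E C u)) = (\<integral>x. f x \<partial>mu (E C (u - E C u))) + (\<integral>x. f x \<partial>mu (E (- C) (u - E C u)))"
    by (intro integral_mu_split domain_diff u w) auto
  moreover have "E C (u + E C u) = 2 *\<^sub>R E C u" "E C (u - E C u) = 0 *\<^sub>R E C u"
    "E (- C) (u + E C u) = E (- C) u" "E (- C) (u - E C u) = E (- C) u"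
    by (simp_all add: E_add E_diff E_idem E_Compl scaleR_2)
  ultimately have "(\<integral>x. f x \<partial>mu (u + E C u)) - (\<integral>x. f x \<partial>mu (u - E C u)) = 4 * (\<integral>x. f x \<partial>mu (E C u))"
    by (simp only: integral_mu_scaleR assms(1)) simp
  then show ?thesis
    using spectral_integral_inner[OF uv w] by (simp add: integral_mu_E)
qed

text \<open>The sign \<sigma> selects the side of \<open>c\<close> on which \<open>C\<close> lies.
  The form of \<sigma> (A - c) is at least \<open>s\<close> there, and the Cauchy-Schwarz inequality
  turns this into a bound on norms.\<close>

lemma spectral_integral_lower_bound:
  assumes [measurable]: "C \<in> sets borel" and \<sigma>: "\<bar>\<sigma>\<bar> = (1::real)"
    and C: "\<And>x. x \<in> C \<Longrightarrow> s \<le> \<sigma> * (x - c)"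
    and uv: "(u, v) \<in> spectral_integral E (\<lambda>x. x)"
  shows "s * norm (E C u) \<le> norm (E C (v - c *\<^sub>R u))"
proof -
  interpret finite_measure "mu u" by (rule finite_mu)
  have "u \<in> spectral_domain E (\<lambda>x. x)"
    using uv unfolding spectral_integral_def by blast
  then have "integrable (mu u) (\<lambda>x. x * indicator C x)"
    by (intro integrable_real_mult_indicator domain_integrable) auto
  then have i: "integrable (mu u) (\<lambda>x. indicator C x * x)"
    by (simp add: mult.commute)
  have i1: "integrable (mu u) (\<lambda>x. indicator C x :: real)"
    by (rule integrable_real_indicator) (auto simp: emeasure_mu)
  have "s * (norm (E C u))\<^sup>2 = (\<integral>x. s * indicator C x \<partial>mu u)"
    by (simp add: measure_mu)
  also have "\<dots> \<le> (\<integral>x. \<sigma> * (indicator C x * x) - \<sigma> * (c * indicator C x) \<partial>mu u)"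
  proof (rule integral_mono)
    show "s * indicator C x \<le> \<sigma> * (indicator C x * x) - \<sigma> * (c * indicator C x)" for x
      using C[of x] by (auto simp: algebra_simps split: split_indicator)
  qed (use i i1 in auto)
  also have "\<dots> = \<sigma> * (\<integral>x. indicator C x * x \<partial>mu u) - \<sigma> * (c * (norm (E C u))\<^sup>2)"
    using i i1 by (simp add: measure_mu)
  also have "\<dots> = \<sigma> * inner (v - c *\<^sub>R u) (E C u)"
    using spectral_integral_inner_E[OF _ _ uv, of C] inner_E_self[of C u]
    by (simp add: inner_diff_left inner_commute algebra_simps)
  also have "inner (v - c *\<^sub>R u) (E C u) = inner (E C (v - c *\<^sub>R u)) (E C u)"
    using symmetric[of C "v - c *\<^sub>R u" "E C u"] by (simp add: E_idem)
  also have "\<sigma> * \<dots> \<le> \<bar>\<sigma> * inner (E C (v - c *\<^sub>R u)) (E C u)\<bar>" by (rule abs_ge_self)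
  also have "\<dots> \<le> norm (E C (v - c *\<^sub>R u)) * norm (E C u)"
    using \<sigma> Cauchy_Schwarz_ineq2 by (simp add: abs_mult)
  finally have "norm (E C u) * (s * norm (E C u)) \<le> norm (E C u) * norm (E C (v - c *\<^sub>R u))"
    by (simp add: power2_eq_square mult_ac)
  then show ?thesis
    by (cases "E C u = 0") (auto dest: mult_left_le_imp_le)
qed

text \<open>
  On the range of \<open>E {c - r..c + r}\<close> the operator is a norm convergent series of projections,
  read off the signed binary expansion of \<open>(x - c) / r\<close>.
\<close>

lemma spectral_integral_bounded_part:
  assumes r: "0 \<le> r" and u: "E {c - r..c + r} u = u"
  shows "\<exists>v. (u, v) \<in> spectral_integral E (\<lambda>x. x) \<and> E {c - r..c + r} v = v \<and> norm (v - c *\<^sub>R u) \<le> r * norm u"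
proof -
  define I where "I = {c - r..c + r}"
  have I [measurable]: "I \<in> sets borel" by (simp add: I_def)
  \<comment> \<open>\<open>B k\<close> is the set where the digit \<open>k\<close> of
    \<open>(x - c) / r\<close> is 1, so \<open>2 *\<^sub>R E (B k) z - z\<close> is that digit
    applied to the operator, and \<open>F k\<close> carries its binary weight.\<close>
  define B where "B k = {x. 0 \<le> digit_rem k ((x - c) / r)}" for k
  have B [measurable]: "B k \<in> sets borel" for k unfolding B_def by measurable
  define F where "F k z = (1/2) ^ Suc k *\<^sub>R (2 *\<^sub>R E (B k) z - z)" for k z
  have nF: "norm (F k z) = (1/2) ^ Suc k * norm z" for k z
  proof -
    have "(norm (2 *\<^sub>R E (B k) z - z))\<^sup>2 = (norm z)\<^sup>2"
      using inner_E_self[OF B, of k z]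
      by (simp add: power2_norm_eq_inner inner_diff_left inner_diff_right inner_commute)
    then show ?thesis by (simp add: F_def)
  qed
  have gs: "(\<lambda>k. (1/2) ^ Suc k * K) sums K" for K :: real
    using sums_mult2[OF power_half_series, of K] by simp
  have sn: "summable (\<lambda>k. norm (F k z))" for z
    unfolding nF using gs by (rule sums_summable)
  have sF: "summable (\<lambda>k. F k z)" for z using sn by (rule summable_norm_cancel)
  define T where "T z = c *\<^sub>R z + r *\<^sub>R (\<Sum>k. F k z)" for z
  have T_add: "T (y + z) = T y + T z" and T_diff: "T (y - z) = T y - T z" for y z
  proof -
    have F: "F k (y + z) = F k y + F k z" "F k (y - z) = F k y - F k z" for k
      by (simp_all add: F_def E_add E_diff algebra_simps)
    show "T (y + z) = T y + T z" "T (y - z) = T y - T z"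
      unfolding T_def F suminf_add[OF sF sF, symmetric] suminf_diff[OF sF sF, symmetric]
      by (simp_all add: algebra_simps)
  qed
  have T_inner: "inner (T y) z = c * inner y z + r * (\<Sum>k. inner (F k y) z)" for y z
    using bounded_linear.suminf[OF bounded_linear_inner_left sF, of y z]
    by (simp add: T_def inner_add_left)
  have T_sym: "inner (T y) z = inner (T z) y" for y z
  proof -
    have F_sym: "inner (F k y) z = inner (F k z) y" for k
      using symmetric[OF B, of k y z] by (simp add: F_def inner_diff_left inner_diff_right inner_commute)
    show ?thesis by (simp only: T_inner F_sym inner_commute[of y z])
  qed
  \<comment> \<open>The expansion represents \<open>x\<close> only on \<open>I\<close>, so
    \<open>T\<close> is compared with the operator only on vectors whose spectral measure is carried
    by \<open>I\<close>.\<close>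
  have form: "(\<integral>x. x \<partial>mu z) = inner (T z) z" if z: "E I z = z" for z
  proof -
    interpret finite_measure "mu z" by (rule finite_mu)
    have "AE x in mu z. x \<in> I"
    proof (rule AE_I[of _ _ "- I"])
      show "emeasure (mu z) (- I) = 0" using z by (simp add: mu_eq_0_iff E_Compl)
    qed auto
    define g where "g k x = (1/2) ^ Suc k * digit k ((x - c) / r)" for k x
    have [measurable]: "g k \<in> borel_measurable borel" for k unfolding g_def by measurable
    have ng: "norm (g k x) = (1/2) ^ Suc k" for k x by (simp add: g_def abs_mult abs_digit)
    have ig: "integrable (mu z) (g k)" for k
      by (rule integrable_const_bound[of _ "(1/2) ^ Suc k"]) (simp_all add: ng del: real_norm_def)
    have "(\<lambda>k. \<integral>x. g k x \<partial>mu z) sums (\<integral>x. (\<Sum>k. g k x) \<partial>mu z)"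
      using ig gs[of 1] gs[of "measure (mu z) UNIV"]
      by (intro sums_integral) (auto simp: ng sums_iff simp del: real_norm_def power_Suc)
    moreover have "(\<integral>x. g k x \<partial>mu z) = inner (F k z) z" for k
    proof -
      have "(\<integral>x. g k x \<partial>mu z) = (\<integral>x. (1/2) ^ Suc k * (2 * indicator (B k) x - 1) \<partial>mu z)"
        by (intro Bochner_Integration.integral_cong) (auto simp: g_def digit_def B_def)
      moreover have "integrable (mu z) (\<lambda>x. indicator (B k) x :: real)"
        by (rule integrable_real_indicator) (auto simp: emeasure_mu)
      then have "(\<integral>x. (1/2) ^ Suc k * (2 * indicator (B k) x - 1) \<partial>mu z) = (1/2) ^ Suc k * (2 * (norm (E (B k) z))\<^sup>2 - (norm z)\<^sup>2)"
        by (simp add: measure_mu)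
      ultimately show ?thesis
        using inner_E_self[OF B, of k z]
        by (simp add: F_def inner_diff_left power2_norm_eq_inner)
    qed
    ultimately have s: "(\<Sum>k. inner (F k z) z) = (\<integral>x. (\<Sum>k. g k x) \<partial>mu z)"
      by (simp add: sums_iff)
    have gi: "integrable (mu z) (\<lambda>x. \<Sum>k. g k x)"
      using ig gs[of 1] gs[of "measure (mu z) UNIV"]
      by (intro integrable_suminf) (auto simp: ng sums_iff simp del: real_norm_def power_Suc)
    have "(\<integral>x. x \<partial>mu z) = (\<integral>x. c + r * (\<Sum>k. g k x) \<partial>mu z)"
    proof (rule integral_cong_AE)
      show "AE x in mu z. x = c + r * (\<Sum>k. g k x)"
        using \<open>AE x in mu z. x \<in> I\<close>
      proof eventually_elim
        case (elim x)
        then have "\<bar>x - c\<bar> \<le> r" by (auto simp: I_def)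
        \<comment> \<open>For \<open>r = 0\<close> the interval is the single point \<open>c\<close>
          and the quotient is 0 by convention, so the expansion remains valid.\<close>
        then have "\<bar>(x - c) / r\<bar> \<le> 1" using r by (cases "r = 0") (auto simp: field_simps)
        from digit_sums[OF this] have "(\<Sum>k. g k x) = (x - c) / r" by (simp add: g_def sums_iff)
        then show ?case using \<open>\<bar>x - c\<bar> \<le> r\<close> by (cases "r = 0") auto
      qed
    qed simp_all
    also have "\<dots> = c * (norm z)\<^sup>2 + r * (\<integral>x. (\<Sum>k. g k x) \<partial>mu z)"
      using gi by (simp add: measure_mu)
    also have "\<dots> = inner (T z) z"
      by (simp add: T_inner s power2_norm_eq_inner)
    finally show ?thesis .
  qed
  define v where "v = E I (T u)"
  have u': "E I u = u" using u by (simp add: I_def)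
  have Ib: "\<bar>x\<bar> \<le> \<bar>c\<bar> + r" if "x \<in> I" for x using that by (auto simp: I_def)
  have ud: "u \<in> spectral_domain E (\<lambda>x. x)"
  proof -
    have "E I u \<in> spectral_domain E (\<lambda>x. x)" by (rule domain_bounded[OF I _ Ib]) auto
    then show ?thesis by (simp add: u')
  qed
  \<comment> \<open>Polarization is localized to \<open>I\<close>: outside, the two arguments are a
    vector and its negative, with equal integrals. Inside, \<open>form\<close> and the symmetry of
    \<open>T\<close> reduce the difference to \<open>4 * inner (T u) (E I w)\<close>.\<close>
  have "inner v w = ((\<integral>x. x \<partial>mu (u + w)) - (\<integral>x. x \<partial>mu (u - w))) / 4"
    if w: "w \<in> spectral_domain E (\<lambda>x. x)" for w
  proof -
    have "(\<integral>x. x \<partial>mu (u + w)) = (\<integral>x. x \<partial>mu (E I (u + w))) + (\<integral>x. x \<partial>mu (E (- I) (u + w)))"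
      by (intro integral_mu_split domain_add ud w) auto
    moreover have "(\<integral>x. x \<partial>mu (u - w)) = (\<integral>x. x \<partial>mu (E I (u - w))) + (\<integral>x. x \<partial>mu (E (- I) (u - w)))"
      by (intro integral_mu_split domain_diff ud w) auto
    moreover have "E (- I) (u + w) = E (- I) w" "E (- I) (u - w) = (- 1) *\<^sub>R E (- I) w"
      by (simp_all add: E_add E_diff E_Compl u')
    moreover have "(\<integral>x. x \<partial>mu ((- 1) *\<^sub>R E (- I) w)) = (\<integral>x. x \<partial>mu (E (- I) w))"
      by (subst integral_mu_scaleR) auto
    moreover have "(\<integral>x. x \<partial>mu (E I (u + w))) = inner (T (u + E I w)) (u + E I w)"
      by (subst form) (simp_all add: E_idem E_add u')
    moreover have "(\<integral>x. x \<partial>mu (E I (u - w))) = inner (T (u - E I w)) (u - E I w)"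
      by (subst form) (simp_all add: E_idem E_diff u')
    moreover have "inner (T (u + E I w)) (u + E I w) - inner (T (u - E I w)) (u - E I w) = 4 * inner (T u) (E I w)"
      using T_sym[of "E I w" u]
      by (simp add: T_add T_diff inner_add_left inner_add_right inner_diff_left inner_diff_right)
    ultimately show ?thesis
      using symmetric[OF I, of "T u" w] by (simp add: v_def)
  qed
  then have "(u, v) \<in> spectral_integral E (\<lambda>x. x)"
    using ud by (simp add: spectral_integral_def)
  moreover have "E I v = v" by (simp add: v_def E_idem)
  \<comment> \<open>The weights of the norm preserving digit operators sum to 1, which gives the
    constant \<open>r\<close> exactly. A larger constant would grow too fast under iteration to
    confine the vector to the interval.\<close>
  moreover have "norm (v - c *\<^sub>R u) \<le> r * norm u"
  proof -
    have "v - c *\<^sub>R u = E I (r *\<^sub>R (\<Sum>k. F k u))"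
      by (simp add: v_def T_def E_add E_scaleR u')
    also have "norm \<dots> \<le> norm (r *\<^sub>R (\<Sum>k. F k u))" by (rule norm_E_le) simp
    also have "\<dots> = r * norm (\<Sum>k. F k u)" using r by simp
    also have "\<dots> \<le> r * (\<Sum>k. norm (F k u))"
      using r sn by (intro mult_left_mono summable_norm) auto
    also have "(\<Sum>k. norm (F k u)) = norm u"
      unfolding nF using gs by (simp only: sums_iff)
    finally show ?thesis .
  qed
  ultimately show ?thesis unfolding I_def by blast
qed

end

text \<open>
  The range of \<open>E {c - r..c + r}\<close> is determined by the operator: it consists of the vectors on
  which the powers of \<open>A - c\<close> grow at most like \<open>r ^ k\<close>, since on the spectral
  subspace of a set at distance \<open>s > r\<close> from \<open>c\<close> they grow at least like \<open>s ^ k\<close>.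
\<close>

lemma spectral_subspace_subset:
  assumes "spectral_resolution E" "spectral_resolution E'"
    and eq: "spectral_integral E (\<lambda>x. x) = spectral_integral E' (\<lambda>x. x)"
    and r: "0 \<le> r" and u: "E {c - r..c + r} u = u"
  shows "E' {c - r..c + r} u = u"
proof -
  interpret E: spectral_resolution E by fact
  interpret E': spectral_resolution E' by fact
  define P where "P w \<longleftrightarrow> E {c - r..c + r} w = w" for w
  \<comment> \<open>\<open>w (Suc n)\<close> is \<open>A - c\<close> applied to \<open>w n\<close>,
    with the operator given as a graph. \<open>P\<close> keeps every iterate in the range of the
    projection, where the next application is possible.\<close>
  have "\<exists>w. \<forall>n. (P (w n) \<and> (n = 0 \<longrightarrow> w n = u)) \<and>
      ((w n, w (Suc n) + c *\<^sub>R w n) \<in> spectral_integral E (\<lambda>x. x) \<and> norm (w (Suc n)) \<le> r * norm (w n))"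
  proof (rule dependent_nat_choice)
    show "\<exists>w. P w \<and> (0 = (0::nat) \<longrightarrow> w = u)" using u by (auto simp: P_def)
    fix w and n :: nat assume "P w \<and> (n = 0 \<longrightarrow> w = u)"
    then obtain v where v: "(w, v) \<in> spectral_integral E (\<lambda>x. x)" "P v" "norm (v - c *\<^sub>R w) \<le> r * norm w"
      using E.spectral_integral_bounded_part[OF r, of c w] by (auto simp: P_def)
    moreover have "P (v - c *\<^sub>R w)"
      using v \<open>P w \<and> _\<close> by (simp add: P_def E.E_diff E.E_scaleR)
    ultimately show "\<exists>y. (P y \<and> (Suc n = 0 \<longrightarrow> y = u)) \<and>
      ((w, y + c *\<^sub>R w) \<in> spectral_integral E (\<lambda>x. x) \<and> norm y \<le> r * norm w)"
      by (intro exI[of _ "v - c *\<^sub>R w"]) simp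
  qed
  then obtain w where w0: "w 0 = u"
    and w: "\<And>n. (w n, w (Suc n) + c *\<^sub>R w n) \<in> spectral_integral E' (\<lambda>x. x)"
      "\<And>n. norm (w (Suc n)) \<le> r * norm (w n)"
    unfolding eq by blast
  have upper: "norm (w n) \<le> r ^ n * norm u" for n
  proof (induction n)
    case (Suc n)
    from mult_left_mono[OF Suc r] w(2)[of n] show ?case by (simp add: mult.assoc)
  qed (simp add: w0)
  \<comment> \<open>The upper bound on the iterates comes from \<open>E\<close>, the lower bound on
    their part in \<open>C\<close> from \<open>E'\<close>; the common graph allows comparing them.
    Since \<open>r < s\<close>, the quotient of the rates tends to 0.\<close>
  have zero: "E' C u = 0"
    if [measurable]: "C \<in> sets borel" and \<sigma>: "\<bar>\<sigma>\<bar> = (1::real)" and s: "r < s"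
      and C: "\<And>x. x \<in> C \<Longrightarrow> s \<le> \<sigma> * (x - c)" for C \<sigma> s
  proof -
    have lower: "s ^ n * norm (E' C u) \<le> norm (E' C (w n))" for n
    proof (induction n)
      case (Suc n)
      have "s * (s ^ n * norm (E' C u)) \<le> s * norm (E' C (w n))"
        using Suc r s by (intro mult_left_mono) auto
      also have "\<dots> \<le> norm (E' C (w (Suc n)))"
        using E'.spectral_integral_lower_bound[OF _ \<sigma> C w(1)[of n]] by simp
      finally show ?case by (simp add: mult.assoc)
    qed (simp add: w0)
    have "norm (E' C u) \<le> (r / s) ^ n * norm u" for n
    proof -
      have "s ^ n * norm (E' C u) \<le> r ^ n * norm u"
        using lower[of n] E'.norm_E_le[of C "w n"] upper[of n] by simp
      moreover have "0 < s ^ n" using r s by simp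
      ultimately show ?thesis by (simp add: power_divide field_simps)
    qed
    moreover have "(\<lambda>n. (r / s) ^ n * norm u) \<longlonglongrightarrow> 0"
      using r s by (intro tendsto_mult_left_zero LIMSEQ_power_zero) auto
    ultimately have "norm (E' C u) \<le> 0"
      by (intro LIMSEQ_le_const) auto
    then show ?thesis by simp
  qed
  \<comment> \<open>The growth argument needs a positive gap, so the complement of the interval is
    exhausted by sets at distance at least \<open>r + inverse (real (Suc n))\<close> from
    \<open>c\<close>, one on each side.\<close>
  have "E' (\<Union>n. {x. r + inverse (real (Suc n)) \<le> x - c} \<union> {x. r + inverse (real (Suc n)) \<le> c - x}) u = 0"
  proof (rule E'.E_eq_0_exhaust)
    fix n
    let ?s = "r + inverse (real (Suc n))"
    have "E' {x. ?s \<le> x - c} u = 0" by (rule zero[of _ 1 ?s]) auto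
    moreover have "E' {x. ?s \<le> c - x} u = 0" by (rule zero[of _ "-1" ?s]) auto
    moreover have "0 < ?s" using r by (simp add: add_nonneg_pos)
    then have "{x. ?s \<le> x - c} \<inter> {x. ?s \<le> c - x} = {}" by auto
    ultimately show "E' ({x. ?s \<le> x - c} \<union> {x. ?s \<le> c - x}) u = 0"
      by (subst E'.E_Un) auto
  qed auto
  moreover have "(\<Union>n. {x. r + inverse (real (Suc n)) \<le> x - c} \<union> {x. r + inverse (real (Suc n)) \<le> c - x})
      = - {c - r..c + r}"
  proof (intro set_eqI iffI)
    fix x assume "x \<in> - {c - r..c + r}"
    then have "0 < \<bar>x - c\<bar> - r" by (auto simp: abs_if)
    then obtain n where "inverse (real (Suc n)) < \<bar>x - c\<bar> - r" using reals_Archimedean by blast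
    then show "x \<in> (\<Union>n. {x. r + inverse (real (Suc n)) \<le> x - c} \<union> {x. r + inverse (real (Suc n)) \<le> c - x})"
      by (auto simp: abs_if split: if_splits intro!: exI[of _ n])
  next
    fix x assume "x \<in> (\<Union>n. {x. r + inverse (real (Suc n)) \<le> x - c} \<union> {x. r + inverse (real (Suc n)) \<le> c - x})"
    then obtain n where "r + inverse (real (Suc n)) \<le> x - c \<or> r + inverse (real (Suc n)) \<le> c - x" by blast
    moreover have "0 < inverse (real (Suc n))" by simp
    ultimately have "r < x - c \<or> r < c - x" by linarith
    then show "x \<in> - {c - r..c + r}" by auto
  qed
  ultimately show ?thesis by (simp add: E'.E_Compl)
qed

text \<open>For a compact interval the projections of \<open>E\<close> and \<open>E'\<close> have
  the same range by the inclusion in both directions, and symmetric projections with the same range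
  are equal. Compact intervals form an intersection-stable generator of the Borel sets.\<close>

lemma spectral_measure_unique:
  assumes E: "spectral_resolution E" and E': "spectral_resolution E'"
    and eq: "spectral_integral E (\<lambda>x. x) = spectral_integral E' (\<lambda>x. x)"
  shows "spectral_measure E u = spectral_measure E' u"
proof -
  interpret E: spectral_resolution E by fact
  interpret E': spectral_resolution E' by fact
  have Icc: "E {a..b} u = E' {a..b} u" for a b u
  proof (cases "a \<le> b")
    case True
    define c r where "c = (a + b) / 2" and "r = (b - a) / 2"
    have r: "0 \<le> r" and I: "{a..b} = {c - r..c + r}" using True by (auto simp: c_def r_def field_simps)
    have 1: "E' {a..b} (E {a..b} y) = E {a..b} y" for y
      unfolding I by (rule spectral_subspace_subset[OF E E' eq r]) (simp add: E.E_idem)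
    have 2: "E {a..b} (E' {a..b} y) = E' {a..b} y" for y
      unfolding I by (rule spectral_subspace_subset[OF E' E eq[symmetric] r]) (simp add: E'.E_idem)
    have "inner (E {a..b} u) y = inner (E' {a..b} u) y" for y
      using E'.symmetric[of "{a..b}" "E {a..b} u" y] E.symmetric[of "{a..b}" u "E' {a..b} y"]
        E'.symmetric[of "{a..b}" u y] 1 2 by simp
    then show ?thesis using vector_eq_rdot by blast
  qed simp
  show ?thesis
  proof (rule measure_eqI_generator_eq[where E = "range (\<lambda>(a, b). {a..b::real})" and \<Omega> = UNIV
        and A = "\<lambda>n. {- real n..real n}"])
    show "Int_stable (range (\<lambda>(a, b). {a..b::real}))"
      by (auto simp: Int_stable_def)
    show "emeasure (spectral_measure E u) X = emeasure (spectral_measure E' u) X"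
      if "X \<in> range (\<lambda>(a, b). {a..b})" for X
      using that by (auto simp: E.emeasure_mu E'.emeasure_mu Icc)
    show "(\<Union>n. {- real n..real n}) = (UNIV :: real set)"
    proof (intro set_eqI iffI UNIV_I)
      fix x :: real
      obtain n where "\<bar>x\<bar> \<le> real n" using real_arch_simple by blast
      then show "x \<in> (\<Union>n. {- real n..real n})" by (intro UN_I[of n]) auto
    qed
  qed (auto simp: borel_eq_atLeastAtMost finite_measure.emeasure_finite[OF E.finite_mu])
qed

text \<open>Domains and spectral integrals depend on the resolution only through its spectral
  measures, so two resolutions of the same operator give the same graph for
  \<open>f\<close>.\<close>

lemma spectral_fun_unique:
  fixes A :: "('h::{real_inner, banach} \<times> 'h) set"
  assumes f: "f \<in> borel_measurable borel"
    and v: "(u, v) \<in> spectral_fun f A" and v': "(u, v') \<in> spectral_fun f A"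
  shows "v = v'"
proof -
  from v obtain E where E: "projection_valued_measure E" "spectral_integral E (\<lambda>x. x) = A"
    "(u, v) \<in> spectral_integral E f" by (auto simp: spectral_fun_def)
  from v' obtain E' where E': "projection_valued_measure E'" "spectral_integral E' (\<lambda>x. x) = A"
    "(u, v') \<in> spectral_integral E' f" by (auto simp: spectral_fun_def)
  have "spectral_measure E = spectral_measure E'"
    using E E' by (intro ext spectral_measure_unique) (auto simp: spectral_resolution_def)
  then have "spectral_integral E' f = spectral_integral E f"
    by (simp add: spectral_integral_def spectral_domain_def)
  with E E' show ?thesis
    by (intro spectral_resolution.spectral_integral_unique[OF _ f, of E]) (auto simp: spectral_resolution_def)
qed

section \<open>Rotations and the sub-Laplacian\<close>

text \<open>For fixed \<open>y\<close> the shear is a translation of the slice, so the claim follows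
  from translation invariance by Fubini.\<close>

lemma distr_shear_fst:
  fixes h :: "'b::euclidean_space \<Rightarrow> 'a::euclidean_space"
  assumes [measurable]: "h \<in> borel_measurable borel"
  shows "distr lborel borel (\<lambda>(x, y). (x + h y, y)) = lborel"
proof (rule measure_eqI)
  let ?f = "\<lambda>(x, y). (x + h y, y)"
  have f [measurable]: "?f \<in> borel_measurable borel" by (simp add: borel_prod[symmetric])
  fix A assume "A \<in> sets (distr lborel borel ?f)"
  then have "A \<in> sets (lborel :: ('a \<times> 'b) measure)" by simp
  then have A: "A \<in> sets (lborel \<Otimes>\<^sub>M lborel)" and A': "A \<in> sets borel" by (simp_all only: lborel_prod sets_lborel)
  have fA: "?f -` A \<in> sets (lborel \<Otimes>\<^sub>M lborel)"
    using measurable_sets[OF f A'] unfolding lborel_prod by simp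
  have "emeasure (distr lborel borel ?f) A = emeasure (lborel \<Otimes>\<^sub>M lborel) (?f -` A)"
    using A' f by (subst emeasure_distr) (simp_all add: lborel_prod)
  also have "\<dots> = (\<integral>\<^sup>+y. emeasure lborel ((\<lambda>x. (x, y)) -` (?f -` A)) \<partial>lborel)"
    using fA by (rule lborel_pair.emeasure_pair_measure_alt2)
  also have "\<dots> = (\<integral>\<^sup>+y. emeasure (distr lborel borel ((+) (h y))) ((\<lambda>x. (x, y)) -` A) \<partial>lborel)"
  proof (rule nn_integral_cong)
    fix y
    have "(\<lambda>x. (x, y)) -` A \<in> sets borel"
      using sets_Pair2[OF A, of y] by simp
    then show "emeasure lborel ((\<lambda>x. (x, y)) -` (?f -` A))
      = emeasure (distr lborel borel ((+) (h y))) ((\<lambda>x. (x, y)) -` A)"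
      by (subst emeasure_distr) (auto simp: vimage_def add.commute)
  qed
  also have "\<dots> = emeasure (lborel \<Otimes>\<^sub>M lborel) A"
    unfolding lborel_distr_plus using A by (rule lborel_pair.emeasure_pair_measure_alt2[symmetric])
  finally show "emeasure (distr lborel borel ?f) A = emeasure lborel A" by (simp add: lborel_prod)
qed simp

lemma distr_shear_snd:
  fixes h :: "'a::euclidean_space \<Rightarrow> 'b::euclidean_space"
  assumes [measurable]: "h \<in> borel_measurable borel"
  shows "distr lborel borel (\<lambda>(x, y). (x, y + h x)) = lborel"
proof (rule measure_eqI)
  let ?f = "\<lambda>(x, y). (x, y + h x)"
  have f [measurable]: "?f \<in> borel_measurable borel" by (simp add: borel_prod[symmetric])
  fix A assume "A \<in> sets (distr lborel borel ?f)"
  then have "A \<in> sets (lborel :: ('a \<times> 'b) measure)" by simp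
  then have A: "A \<in> sets (lborel \<Otimes>\<^sub>M lborel)" and A': "A \<in> sets borel" by (simp_all only: lborel_prod sets_lborel)
  have fA: "?f -` A \<in> sets (lborel \<Otimes>\<^sub>M lborel)"
    using measurable_sets[OF f A'] unfolding lborel_prod by simp
  have "emeasure (distr lborel borel ?f) A = emeasure (lborel \<Otimes>\<^sub>M lborel) (?f -` A)"
    using A' f by (subst emeasure_distr) (simp_all add: lborel_prod)
  also have "\<dots> = (\<integral>\<^sup>+x. emeasure lborel (Pair x -` (?f -` A)) \<partial>lborel)"
    using fA by (rule lborel.emeasure_pair_measure_alt)
  also have "\<dots> = (\<integral>\<^sup>+x. emeasure (distr lborel borel ((+) (h x))) (Pair x -` A) \<partial>lborel)"
  proof (rule nn_integral_cong)
    fix x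
    have "Pair x -` A \<in> sets borel"
      using sets_Pair1[OF A, of x] by simp
    then show "emeasure lborel (Pair x -` (?f -` A))
      = emeasure (distr lborel borel ((+) (h x))) (Pair x -` A)"
      by (subst emeasure_distr) (auto simp: vimage_def add.commute)
  qed
  also have "\<dots> = emeasure (lborel \<Otimes>\<^sub>M lborel) A"
    unfolding lborel_distr_plus using A by (rule lborel.emeasure_pair_measure_alt[symmetric])
  finally show "emeasure (distr lborel borel ?f) A = emeasure lborel A" by (simp add: lborel_prod)
qed simp

lemma horizontal_rotation_Pair [simp]:
  "horizontal_rotation \<theta> (x, y, z) = (cos \<theta> *\<^sub>R x + sin \<theta> *\<^sub>R y, cos \<theta> *\<^sub>R y - sin \<theta> *\<^sub>R x, z)"
  by (simp add: horizontal_rotation_def)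

lemma horizontal_rotation_add:
  "horizontal_rotation \<theta> (horizontal_rotation \<eta> q) = horizontal_rotation (\<theta> + \<eta>) q"
  by (cases q) (simp add: cos_add sin_add algebra_simps)

lemma horizontal_rotation_0 [simp]: "horizontal_rotation 0 q = q"
  by (cases q) simp

lemma bounded_linear_horizontal_rotation: "bounded_linear (horizontal_rotation \<theta>)"
  unfolding horizontal_rotation_def split_beta'
  by (intro bounded_linear_intros)

lemma horizontal_rotation_measurable [measurable]: "horizontal_rotation \<theta> \<in> borel_measurable borel"
  by (intro borel_measurable_continuous_onI linear_continuous_on bounded_linear_horizontal_rotation)

text \<open>A rotation by an angle with nonzero sine is a product of three shears.\<close>

lemma distr_horizontal_rotation:
  "distr lborel borel (horizontal_rotation \<theta> :: 'n::finite heis \<Rightarrow> 'n heis) = lborel"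
proof -
  have *: "distr lborel borel (horizontal_rotation \<theta> :: 'n heis \<Rightarrow> 'n heis) = lborel" if s: "sin \<theta> \<noteq> 0" for \<theta>
  proof -
    \<comment> \<open>This is tan(\<theta>/2), chosen so that
      \<open>1 - a * sin \<theta> = cos \<theta>\<close>; the remaining entry of the product of the
      three shears is then \<open>a + a * cos \<theta> = sin \<theta>\<close>.\<close>
    define a where "a = (1 - cos \<theta>) / sin \<theta>"
    define S :: "'n heis \<Rightarrow> 'n heis" where "S = (\<lambda>(x, p). (x + a *\<^sub>R fst p, p))"
    define T :: "'n heis \<Rightarrow> 'n heis" where "T = (\<lambda>(x, p). (x, p + (- sin \<theta> *\<^sub>R x, 0)))"
    have S: "distr lborel borel S = lborel" unfolding S_def 
      by (rule distr_shear_fst) (intro borel_measurable_continuous_onI continuous_intros)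
    have T: "distr lborel borel T = lborel"
      unfolding T_def
      by (rule distr_shear_snd) (intro borel_measurable_continuous_onI continuous_intros)
    have [measurable]: "S \<in> borel_measurable borel" "T \<in> borel_measurable borel"
      unfolding S_def T_def split_beta' by (intro borel_measurable_continuous_onI continuous_intros)+
    have ac: "1 - a * sin \<theta> = cos \<theta>" using s by (simp add: a_def)
    have as: "a + a * cos \<theta> = sin \<theta>"
    proof -
      have "(1 - cos \<theta>) * (1 + cos \<theta>) = sin \<theta> * sin \<theta>"
        using sin_cos_squared_add[of \<theta>] by (simp add: power2_eq_square algebra_simps)
      then show ?thesis using s by (simp add: a_def field_simps)
    qed
    have "horizontal_rotation \<theta> = (\<lambda>q. S (T (S q)))"
    proof (rule ext, goal_cases)
      case (1 q)
      obtain x y z where q: "q = (x, y, z)" by (cases q)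
      have "x + a *\<^sub>R y + a *\<^sub>R (y - sin \<theta> *\<^sub>R (x + a *\<^sub>R y)) = (1 - a * sin \<theta>) *\<^sub>R x + (a + a * (1 - a * sin \<theta>)) *\<^sub>R y"
        by (simp add: vec_eq_iff algebra_simps)
      moreover have "y - sin \<theta> *\<^sub>R (x + a *\<^sub>R y) = (1 - a * sin \<theta>) *\<^sub>R y - sin \<theta> *\<^sub>R x"
        by (simp add: vec_eq_iff algebra_simps)
      ultimately show ?case
        unfolding ac as by (simp add: q S_def T_def)
    qed
    then have "distr lborel borel (horizontal_rotation \<theta> :: 'n heis \<Rightarrow> 'n heis)
        = distr (distr (distr lborel borel S) borel T) borel S"
      by (simp add: distr_distr comp_def)
    then show ?thesis by (simp add: S T)
  qed
  show ?thesis
  proof (cases "sin \<theta> = 0")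
    case True
    then consider "cos \<theta> = 1" | "cos \<theta> = -1"
      using sin_cos_squared_add[of \<theta>] by (auto simp: power2_eq_1_iff)
    then show ?thesis
    proof cases
      case 1
      then have "horizontal_rotation \<theta> = (\<lambda>q::'n heis. q)" using True by (auto simp: horizontal_rotation_def)
      then show ?thesis by (simp add: distr_id2)
    next
      case 2
      \<comment> \<open>The half turn has sine 0 but is the square of a rotation by half the angle,
        whose sine is nonzero.\<close>
      have "cos \<theta> = 1 - 2 * (sin (\<theta> / 2))\<^sup>2" using cos_double_sin[of "\<theta> / 2"] by simp
      then have s: "sin (\<theta> / 2) \<noteq> 0" using 2 by auto
      have "horizontal_rotation \<theta> = (\<lambda>q::'n heis. horizontal_rotation (\<theta> / 2) (horizontal_rotation (\<theta> / 2) q))"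
        by (simp add: horizontal_rotation_add)
      then have "distr lborel borel (horizontal_rotation \<theta> :: 'n heis \<Rightarrow> 'n heis)
        = distr (distr lborel borel (horizontal_rotation (\<theta> / 2))) borel (horizontal_rotation (\<theta> / 2))"
        by (simp add: distr_distr comp_def)
      then show ?thesis by (simp add: *[OF s])
    qed
  qed (rule *)
qed

section \<open>Test functions under linear maps\<close>

text \<open>By the chain rule the derivative of \<open>f\<close> after \<open>L\<close> in direction
  \<open>v\<close> is the derivative of \<open>f\<close> in the fixed direction \<open>L v\<close>,
  again composed with \<open>L\<close>, so the induction closes over \<open>f\<close>.\<close>

lemma Ck_compose_linear:
  assumes L: "bounded_linear L" and "Ck k f"
  shows "Ck k (\<lambda>q. f (L q))"
  using assms(2)
proof (induction k arbitrary: f)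
  case 0
  then show ?case
    using continuous_on_compose2[of UNIV f UNIV L] linear_continuous_on[OF L] by auto
next
  case (Suc k)
  have d: "((\<lambda>q. f (L q)) has_derivative (\<lambda>v. frechet_derivative f (at (L q)) (L v))) (at q)" for q
  proof (rule has_derivative_compose[where f = L and f' = L and g = f])
    show "(L has_derivative L) (at q)" using L by (rule bounded_linear_imp_has_derivative)
    show "(f has_derivative frechet_derivative f (at (L q))) (at (L q))"
      using Suc.prems by (simp add: frechet_derivative_works)
  qed
  then have "frechet_derivative (\<lambda>q. f (L q)) (at q) = (\<lambda>v. frechet_derivative f (at (L q)) (L v))" for q
    by (rule frechet_derivative_at[symmetric])
  moreover have "Ck k (\<lambda>q. frechet_derivative f (at (L q)) (L v))" for v
    by (rule Suc.IH) (use Suc.prems in auto)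
  ultimately show ?case using d by (auto simp: differentiable_def)
qed

lemma test_function_rotation:
  assumes "test_function f"
  shows "test_function (\<lambda>q. f (horizontal_rotation \<theta> q))"
proof -
  let ?S = "closure {q. f q \<noteq> 0}"
  have "{q. f (horizontal_rotation \<theta> q) \<noteq> 0} \<subseteq> horizontal_rotation (- \<theta>) ` ?S"
  proof
    fix q assume "q \<in> {q. f (horizontal_rotation \<theta> q) \<noteq> 0}"
    then have "horizontal_rotation \<theta> q \<in> ?S" using closure_subset[of "{q. f q \<noteq> 0}"] by auto
    moreover have "q = horizontal_rotation (- \<theta>) (horizontal_rotation \<theta> q)"
      by (simp add: horizontal_rotation_add)
    ultimately show "q \<in> horizontal_rotation (- \<theta>) ` ?S" by blast
  qed
  moreover have "bounded (horizontal_rotation (- \<theta>) ` ?S)"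
    using assms by (intro compact_imp_bounded compact_continuous_image linear_continuous_on
        bounded_linear_horizontal_rotation) (simp add: test_function_def)
  ultimately have "bounded {q. f (horizontal_rotation \<theta> q) \<noteq> 0}" by (rule bounded_subset[rotated])
  then show ?thesis
    using assms Ck_compose_linear[OF bounded_linear_horizontal_rotation]
    by (auto simp: test_function_def compact_closure)
qed

text \<open>Common form of \<open>X_field\<close> and \<open>Y_field\<close>: the derivative along
  \<open>a + l q *\<^sub>R b\<close>, with \<open>l\<close> linear. Regularity, locality and
  linearity are proved once for both.\<close>

definition affine_field ::
    "'a \<Rightarrow> 'a \<Rightarrow> ('a \<Rightarrow> real) \<Rightarrow> ('a::real_normed_vector \<Rightarrow> real) \<Rightarrow> 'a \<Rightarrow> real" where
  "affine_field a b l f q = frechet_derivative f (at q) a + l q * frechet_derivative f (at q) b"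

lemma X_field_affine: "X_field i = affine_field (axis i 1, 0, 0) (0, 0, 1) (\<lambda>q. 2 * fst (snd q) $ i)"
  by (auto simp: fun_eq_iff X_field_def affine_field_def)

lemma Y_field_affine: "Y_field i = affine_field (0, axis i 1, 0) (0, 0, 1) (\<lambda>q. - 2 * fst q $ i)"
  by (auto simp: fun_eq_iff Y_field_def affine_field_def)

lemma bounded_linear_coefficients:
  "bounded_linear (\<lambda>q :: 'n::finite heis. 2 * fst (snd q) $ i)"
  "bounded_linear (\<lambda>q :: 'n::finite heis. - 2 * fst q $ i)"
  by (intro bounded_linear_const_mult bounded_linear_compose[OF bounded_linear_vec_nth] bounded_linear_intros)+

lemma affine_field_has_derivative:
  assumes f: "Ck 2 f" and l: "bounded_linear l"
  shows "(affine_field a b l f has_derivative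
    (\<lambda>v. frechet_derivative (\<lambda>q. frechet_derivative f (at q) a) (at q) v
       + (l q * frechet_derivative (\<lambda>q. frechet_derivative f (at q) b) (at q) v
          + l v * frechet_derivative f (at q) b))) (at q)"
proof -
  have D: "((\<lambda>q. frechet_derivative f (at q) a) has_derivative
      frechet_derivative (\<lambda>q. frechet_derivative f (at q) a) (at q)) (at q)" for a
    using f by (simp add: numeral_2_eq_2 frechet_derivative_works[symmetric])
  show ?thesis
    unfolding affine_field_def[abs_def]
    by (intro has_derivative_add has_derivative_mult D bounded_linear_imp_has_derivative l)
qed

lemma affine_field_differentiable:
  "Ck 2 f \<Longrightarrow> bounded_linear l \<Longrightarrow> affine_field a b l f differentiable (at q)"
  unfolding differentiable_def by (rule exI) (rule affine_field_has_derivative)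

lemma affine_field_twice_continuous:
  assumes f: "Ck 2 f" and l: "bounded_linear l"
  shows "continuous_on UNIV (affine_field a b l (affine_field a b l f))"
proof -
  have c2: "continuous_on UNIV (\<lambda>q. frechet_derivative (\<lambda>q. frechet_derivative f (at q) a) (at q) v)" for a v
    using f by (simp add: numeral_2_eq_2)
  have c1: "continuous_on UNIV (\<lambda>q. frechet_derivative f (at q) a)" for a
    using f by (intro differentiable_imp_continuous_on)
      (simp add: numeral_2_eq_2 differentiable_on_def)
  have c0: "continuous_on UNIV l" using l by (rule linear_continuous_on)
  show ?thesis
    unfolding affine_field_def[of a b l "affine_field a b l f", abs_def]
      frechet_derivative_at[OF affine_field_has_derivative[OF f l], symmetric]
    by (intro continuous_intros c0 c1 c2)
qed

lemma affine_field_eq_0: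
  assumes U: "open U" and 0: "\<And>q. q \<in> U \<Longrightarrow> f q = 0" and q: "q \<in> U"
  shows "affine_field a b l f q = 0"
proof -
  have "(f has_derivative (\<lambda>_. 0)) (at q)"
    by (rule has_derivative_transform_within_open[OF has_derivative_const U q, of 0]) (simp add: 0)
  then have "frechet_derivative f (at q) = (\<lambda>_. 0)" by (rule frechet_derivative_at[symmetric])
  then show ?thesis by (simp add: affine_field_def)
qed

lemma affine_field_lincomb:
  assumes "g differentiable (at q)" "h differentiable (at q)"
  shows "affine_field a b l (\<lambda>q. c * g q + d * h q) q = c * affine_field a b l g q + d * affine_field a b l h q"
proof -
  have "((\<lambda>q. c * g q + d * h q) has_derivative
    (\<lambda>v. c * frechet_derivative g (at q) v + d * frechet_derivative h (at q) v)) (at q)"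
    using assms by (intro has_derivative_add has_derivative_mult_right)
      (simp_all add: frechet_derivative_works[symmetric])
  from frechet_derivative_at[OF this, symmetric] show ?thesis
    by (simp add: affine_field_def algebra_simps)
qed

lemma X_field_lincomb:
  assumes "g differentiable (at q)" "h differentiable (at q)"
  shows "X_field i (\<lambda>q. c * g q + d * h q) q = c * X_field i g q + d * X_field i h q"
  unfolding X_field_affine by (rule affine_field_lincomb[OF assms])

lemma Y_field_lincomb:
  assumes "g differentiable (at q)" "h differentiable (at q)"
  shows "Y_field i (\<lambda>q. c * g q + d * h q) q = c * Y_field i g q + d * Y_field i h q"
  unfolding Y_field_affine by (rule affine_field_lincomb[OF assms])

lemma affine_field_vector:
  assumes "f differentiable (at q)"
  shows "affine_field a b l f q = frechet_derivative f (at q) (a + l q *\<^sub>R b)"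
proof -
  have "linear (frechet_derivative f (at q))"
    using assms by (rule linear_frechet_derivative)
  then show ?thesis by (simp add: affine_field_def linear_add linear_scale)
qed

lemma sq_integrable_compact_support:
  assumes f: "continuous_on UNIV f" and S: "compact S" and 0: "\<And>q. q \<notin> S \<Longrightarrow> f q = 0"
  shows "sq_integrable f"
proof -
  have "integrable lborel (\<lambda>q. indicator S q *\<^sub>R (f q)\<^sup>2)"
    by (rule borel_integrable_compact[OF S])
      (intro continuous_intros continuous_on_subset[OF f] subset_UNIV)
  also have "(\<lambda>q. indicator S q *\<^sub>R (f q)\<^sup>2) = (\<lambda>q. (f q)\<^sup>2)"
    using 0 by (auto simp: indicator_def fun_eq_iff)
  finally show ?thesis
    using borel_measurable_continuous_onI[OF f] by (simp add: sq_integrable_def)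
qed

lemma test_function_sq_integrable:
  assumes "test_function f"
  shows "sq_integrable f"
proof (rule sq_integrable_compact_support)
  have "Ck 0 f" using assms unfolding test_function_def by blast
  then show "continuous_on UNIV f" by simp
  show "compact (closure {q. f q \<noteq> 0})" using assms by (simp add: test_function_def)
  show "f q = 0" if "q \<notin> closure {q. f q \<noteq> 0}" for q
    using that closure_subset[of "{q. f q \<noteq> 0}"] by auto
qed

lemma sub_laplacian_sq_integrable:
  assumes f: "test_function f"
  shows "sq_integrable (sub_laplacian f)"
proof (rule sq_integrable_compact_support)
  have C2: "Ck 2 f" using f unfolding test_function_def by blast
  show "continuous_on UNIV (sub_laplacian f)"
    unfolding sub_laplacian_def[abs_def] X_field_affine Y_field_affine
    by (intro continuous_on_sum continuous_on_add affine_field_twice_continuous C2 bounded_linear_coefficients)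
  show "compact (closure {q. f q \<noteq> 0})" using f by (simp add: test_function_def)
  let ?U = "- closure {q. f q \<noteq> 0}"
  have U: "open ?U" by auto
  have f0: "f q = 0" if "q \<in> ?U" for q using that closure_subset[of "{q. f q \<noteq> 0}"] by auto
  have "affine_field a b l (affine_field a b l f) q = 0" if "q \<in> ?U" for a b l q
    by (rule affine_field_eq_0[OF U affine_field_eq_0[OF U f0] that])
  then show "sub_laplacian f q = 0" if "q \<notin> closure {q. f q \<noteq> 0}" for q
    unfolding sub_laplacian_def X_field_affine Y_field_affine
    using that by simp
qed

section \<open>Rotation of the horizontal fields\<close>

text \<open>The rotation is linear, so the chain rule moves it onto the direction vector. Only the
  vertical component needs an argument: the mixed products of sine and cosine cancel and the squares
  add up to 1.\<close>

lemma X_field_rotation: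
  assumes f: "\<And>q. f differentiable (at q)"
  shows "X_field i (\<lambda>q. f (horizontal_rotation \<theta> q)) q =
    cos \<theta> * X_field i f (horizontal_rotation \<theta> q) + (- sin \<theta>) * Y_field i f (horizontal_rotation \<theta> q)"
    (is ?X)
  and Y_field_rotation:
  "Y_field i (\<lambda>q. f (horizontal_rotation \<theta> q)) q =
    sin \<theta> * X_field i f (horizontal_rotation \<theta> q) + cos \<theta> * Y_field i f (horizontal_rotation \<theta> q)"
    (is ?Y)
proof -
  let ?R = "horizontal_rotation \<theta>"
  let ?D = "frechet_derivative f (at (?R q))"
  have d: "((\<lambda>q. f (?R q)) has_derivative (\<lambda>v. ?D (?R v))) (at q)"
  proof (rule has_derivative_compose[where f = ?R and f' = ?R and g = f])
    show "(?R has_derivative ?R) (at q)"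
      by (rule bounded_linear_imp_has_derivative[OF bounded_linear_horizontal_rotation])
    show "(f has_derivative ?D) (at (?R q))" using f by (simp add: frechet_derivative_works[symmetric])
  qed
  then have fd: "(\<lambda>q. f (?R q)) differentiable (at q)" by (auto simp: differentiable_def)
  have D: "linear ?D" using f by (rule linear_frechet_derivative)
  obtain x y z where q: "q = (x, y, z)" by (cases q)
  have cs: "cos \<theta> * (cos \<theta> * t) + sin \<theta> * (sin \<theta> * t) = t" for t
    using sin_cos_squared_add[of \<theta>]
    by (simp add: power2_eq_square mult.assoc[symmetric] distrib_right[symmetric] add.commute)
  have "?R ((axis i 1, 0, 0) + (2 * fst (snd q) $ i) *\<^sub>R (0, 0, 1))
    = cos \<theta> *\<^sub>R ((axis i 1, 0, 0) + (2 * fst (snd (?R q)) $ i) *\<^sub>R (0, 0, 1))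
      + (- sin \<theta>) *\<^sub>R ((0, axis i 1, 0) + (- 2 * fst (?R q) $ i) *\<^sub>R (0, 0, 1))"
    using cs[of "y $ i"] by (simp add: q algebra_simps)
  then show ?X
    unfolding X_field_affine Y_field_affine affine_field_vector[OF f] affine_field_vector[OF fd]
      frechet_derivative_at[OF d, symmetric]
    by (simp only: linear_add[OF D] linear_scale[OF D] real_scaleR_def)
  have "?R ((0, axis i 1, 0) + (- 2 * fst q $ i) *\<^sub>R (0, 0, 1))
    = sin \<theta> *\<^sub>R ((axis i 1, 0, 0) + (2 * fst (snd (?R q)) $ i) *\<^sub>R (0, 0, 1))
      + cos \<theta> *\<^sub>R ((0, axis i 1, 0) + (- 2 * fst (?R q) $ i) *\<^sub>R (0, 0, 1))"
    using cs[of "x $ i"] by (simp add: q algebra_simps)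
  then show ?Y
    unfolding X_field_affine Y_field_affine affine_field_vector[OF f] affine_field_vector[OF fd]
      frechet_derivative_at[OF d, symmetric]
    by (simp only: linear_add[OF D] linear_scale[OF D] real_scaleR_def)
qed

text \<open>The pair of fields is rotated by an orthogonal matrix, applied twice. The terms of type
  X Y and those of type Y X cancel separately, so the noncommutativity of the fields does no harm,
  and the squares recombine.\<close>

lemma sub_laplacian_rotation:
  assumes f: "test_function f"
  shows "sub_laplacian (\<lambda>q. f (horizontal_rotation \<theta> q)) q = sub_laplacian f (horizontal_rotation \<theta> q)"
proof -
  let ?R = "horizontal_rotation \<theta>"
  let ?c = "cos \<theta>" and ?s = "sin \<theta>"
  have C2: "Ck 2 f" using f unfolding test_function_def by blast
  have fd: "f differentiable (at q)" for q
    using C2 unfolding numeral_2_eq_2 Ck.simps by blast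
  have "X_field i (X_field i (\<lambda>q. f (?R q))) q + Y_field i (Y_field i (\<lambda>q. f (?R q))) q
    = X_field i (X_field i f) (?R q) + Y_field i (Y_field i f) (?R q)" for i
  proof -
    have Xd: "X_field i f differentiable (at q)" and Yd: "Y_field i f differentiable (at q)" for q
      unfolding X_field_affine Y_field_affine
      by (intro affine_field_differentiable C2 bounded_linear_coefficients)+
    have lc: "(\<lambda>q. c * X_field i f q + d * Y_field i f q) differentiable (at q)" for c d q
      using Xd Yd by (intro differentiable_add differentiable_mult differentiable_const)
    have XX: "X_field i (\<lambda>q. c * X_field i f q + d * Y_field i f q) p
        = c * X_field i (X_field i f) p + d * X_field i (Y_field i f) p"
      and YY: "Y_field i (\<lambda>q. c * X_field i f q + d * Y_field i f q) p
        = c * Y_field i (X_field i f) p + d * Y_field i (Y_field i f) p" for c d p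
      by (rule X_field_lincomb[OF Xd Yd] Y_field_lincomb[OF Xd Yd])+
    have XR: "X_field i (\<lambda>q. f (?R q)) = (\<lambda>q. ?c * X_field i f (?R q) + (- ?s) * Y_field i f (?R q))"
      and YR: "Y_field i (\<lambda>q. f (?R q)) = (\<lambda>q. ?s * X_field i f (?R q) + ?c * Y_field i f (?R q))"
      by (intro ext X_field_rotation Y_field_rotation fd)+
    have "X_field i (X_field i (\<lambda>q. f (?R q))) q
      = X_field i (\<lambda>q. (\<lambda>p. ?c * X_field i f p + (- ?s) * Y_field i f p) (?R q)) q"
      by (simp only: XR)
    also have "\<dots> = ?c * (?c * X_field i (X_field i f) (?R q) + (- ?s) * X_field i (Y_field i f) (?R q))
      + (- ?s) * (?c * Y_field i (X_field i f) (?R q) + (- ?s) * Y_field i (Y_field i f) (?R q))"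
      by (simp only: X_field_rotation[where f = "\<lambda>p. ?c * X_field i f p + (- ?s) * Y_field i f p", OF lc] XX YY)
    finally have 1: "X_field i (X_field i (\<lambda>q. f (?R q))) q = \<dots>" .
    have "Y_field i (Y_field i (\<lambda>q. f (?R q))) q
      = Y_field i (\<lambda>q. (\<lambda>p. ?s * X_field i f p + ?c * Y_field i f p) (?R q)) q"
      by (simp only: YR)
    also have "\<dots> = ?s * (?s * X_field i (X_field i f) (?R q) + ?c * X_field i (Y_field i f) (?R q))
      + ?c * (?s * Y_field i (X_field i f) (?R q) + ?c * Y_field i (Y_field i f) (?R q))"
      by (simp only: Y_field_rotation[where f = "\<lambda>p. ?s * X_field i f p + ?c * Y_field i f p", OF lc] XX YY)
    finally have 2: "Y_field i (Y_field i (\<lambda>q. f (?R q))) q = \<dots>" .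
    have "?c * ?c + ?s * ?s = 1"
      using sin_cos_squared_add[of \<theta>] by (simp add: power2_eq_square add.commute)
    then show ?thesis unfolding 1 2 by algebra
  qed
  then show ?thesis by (simp add: sub_laplacian_def)
qed

section \<open>Invariance of the fractional powers\<close>

lemma isometry_bounded_linear:
  fixes U :: "'h::real_inner \<Rightarrow> 'h"
  assumes "linear U" "\<And>u v. inner (U u) (U v) = inner u v"
  shows "bounded_linear U"
proof (rule bounded_linear_intro[of _ 1])
  show "norm (U u) \<le> norm u * 1" for u
    unfolding norm_eq_sqrt_inner assms(2) by simp
qed (use assms(1) in \<open>simp_all add: linear_add linear_scale\<close>)

section \<open>Conjugation of resolutions by a unitary operator\<close>

locale unitary =
  fixes U V :: "'h::real_inner \<Rightarrow> 'h"
  assumes U: "linear U" and V: "linear V"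
    and VU [simp]: "\<And>u. V (U u) = u" and UV [simp]: "\<And>u. U (V u) = u"
    and isometry: "\<And>u v. inner (U u) (U v) = inner u v"
begin

lemma inner_U: "inner (U u) v = inner u (V v)"
  using isometry[of u "V v"] by simp

lemma inner_U_right: "inner u (U v) = inner (V u) v"
  using isometry[of "V u" v] by simp

definition conj_pvm where "conj_pvm E B u = U (E B (V u))" for E :: "real set \<Rightarrow> 'h \<Rightarrow> 'h"

lemma projection_valued_measure_conj:
  assumes "projection_valued_measure E"
  shows "projection_valued_measure (conj_pvm E)"
proof -
  note E = assms[unfolded projection_valued_measure_def]
  have lin: "linear (E B)" and sym: "inner (E B u) v = inner u (E B v)" if "B \<in> sets borel" for B u v
    using E[THEN conjunct1] that by blast+
  have UN: "E UNIV = id" using E by blast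
  have Int: "E (B \<inter> C) = E B \<circ> E C" if "B \<in> sets borel" "C \<in> sets borel" for B C
    using E[THEN conjunct2, THEN conjunct2, THEN conjunct1] that by blast
  note sums = E[THEN conjunct2, THEN conjunct2, THEN conjunct2, rule_format]
  show ?thesis
    unfolding projection_valued_measure_def
  proof (intro conjI ballI allI impI)
    fix B :: "real set" assume B: "B \<in> sets borel"
    show "linear (conj_pvm E B)"
      using linear_compose[OF linear_compose[OF V lin[OF B]] U]
      by (simp add: conj_pvm_def[abs_def] comp_def)
    show "inner (conj_pvm E B u) v = inner u (conj_pvm E B v)" for u v
      unfolding conj_pvm_def inner_U inner_U_right by (rule sym[OF B])
    show "conj_pvm E (B \<inter> C) = conj_pvm E B \<circ> conj_pvm E C" if "C \<in> sets borel" for C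
      by (simp add: fun_eq_iff conj_pvm_def Int[OF B that])
  next
    show "conj_pvm E UNIV = id"
      by (simp add: fun_eq_iff conj_pvm_def UN)
  next
    fix B :: "nat \<Rightarrow> real set" and u assume "range B \<subseteq> sets borel" "disjoint_family B"
    then show "(\<lambda>i. conj_pvm E (B i) u) sums conj_pvm E (\<Union>i. B i) u"
      unfolding conj_pvm_def
      by (intro bounded_linear.sums[OF isometry_bounded_linear[OF U isometry]] sums)
  qed
qed

lemma spectral_measure_conj: "spectral_measure (conj_pvm E) u = spectral_measure E (V u)"
  by (simp add: spectral_measure_def conj_pvm_def inner_U)

lemma spectral_domain_conj: "u \<in> spectral_domain (conj_pvm E) f \<longleftrightarrow> V u \<in> spectral_domain E f"
  by (simp add: spectral_domain_def spectral_measure_conj)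

text \<open>\<open>V\<close> maps the domain for the conjugate resolution onto the one for
  \<open>E\<close>, so the quantifier over test vectors can be reindexed along it.\<close>

lemma spectral_integral_conj:
  "(u, v) \<in> spectral_integral (conj_pvm E) f \<longleftrightarrow> (V u, V v) \<in> spectral_integral E f"
proof -
  have "(\<forall>w\<in>spectral_domain (conj_pvm E) f. P (V w)) \<longleftrightarrow> (\<forall>w\<in>spectral_domain E f. P w)" for P
    by (metis VU spectral_domain_conj)
  note all = this
  have inner: "inner v w = inner (V v) (V w)" for w
    using inner_U[of "V v" w] by simp
  show ?thesis
    unfolding spectral_integral_def mem_Collect_eq case_prod_conv spectral_measure_conj
      linear_add[OF V] linear_diff[OF V] inner
      all[of "\<lambda>w. inner (V v) w = ((\<integral>x. f x \<partial>spectral_measure E (V u + w))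
        - (\<integral>x. f x \<partial>spectral_measure E (V u - w))) / 4"]
    by (simp only: spectral_domain_conj)
qed

lemma spectral_fun_invariant:
  assumes A: "\<And>u v. (u, v) \<in> A \<longleftrightarrow> (V u, V v) \<in> A"
    and uv: "(u, v) \<in> spectral_fun f A"
  shows "(U u, U v) \<in> spectral_fun f A"
proof -
  from uv obtain E where E: "projection_valued_measure E" "spectral_integral E (\<lambda>x. x) = A"
    "(u, v) \<in> spectral_integral E f" by (auto simp: spectral_fun_def)
  have "p \<in> spectral_integral (conj_pvm E) (\<lambda>x. x) \<longleftrightarrow> p \<in> A" for p
    using A[of "fst p" "snd p"] spectral_integral_conj[of "fst p" "snd p" E "\<lambda>x. x"]
    unfolding E(2) prod.collapse by blast
  then have "spectral_integral (conj_pvm E) (\<lambda>x. x) = A" by blast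
  moreover have "(U u, U v) \<in> spectral_integral (conj_pvm E) f"
    unfolding spectral_integral_conj VU by (rule E(3))
  ultimately show ?thesis
    using projection_valued_measure_conj[OF E(1)] unfolding spectral_fun_def by blast
qed

end

section \<open>Rotations acting on square integrable functions\<close>

lemma AE_rotation:
  assumes "AE q in lborel. P (q :: 'n::finite heis)"
  shows "AE q in lborel. P (horizontal_rotation \<theta> q)"
proof -
  have "AE q in distr lborel borel (horizontal_rotation \<theta>). P q"
    unfolding distr_horizontal_rotation by (rule assms)
  then show ?thesis by (rule AE_distrD[rotated]) simp
qed

lemma nn_integral_rotation:
  fixes f :: "'n::finite heis \<Rightarrow> ennreal"
  assumes "f \<in> borel_measurable borel"
  shows "(\<integral>\<^sup>+q. f (horizontal_rotation \<theta> q) \<partial>lborel) = (\<integral>\<^sup>+q. f q \<partial>lborel)"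
  using assms nn_integral_distr[of "horizontal_rotation \<theta> :: 'n heis \<Rightarrow> _" lborel borel f]
  by (simp add: distr_horizontal_rotation)

lemma integral_rotation:
  fixes f :: "'n::finite heis \<Rightarrow> real"
  assumes "f \<in> borel_measurable borel"
  shows "(\<integral>q. f (horizontal_rotation \<theta> q) \<partial>lborel) = (\<integral>q. f q \<partial>lborel)"
  using assms integral_distr[of "horizontal_rotation \<theta> :: 'n heis \<Rightarrow> _" lborel borel f]
  by (simp add: distr_horizontal_rotation)

lemma sq_integrable_rotation:
  fixes f :: "'n::finite heis \<Rightarrow> real"
  assumes "sq_integrable f"
  shows "sq_integrable (\<lambda>q. f (horizontal_rotation \<theta> q))"
proof -
  have [measurable]: "f \<in> borel_measurable borel" using assms by (simp add: sq_integrable_def)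
  have "integrable (distr lborel borel (horizontal_rotation \<theta> :: 'n heis \<Rightarrow> 'n heis)) (\<lambda>q. (f q)\<^sup>2)"
    using assms by (simp add: distr_horizontal_rotation sq_integrable_def)
  then show ?thesis
    by (simp add: sq_integrable_def integrable_distr_eq)
qed

definition rot_L2 :: "real \<Rightarrow> 'n::finite heis L2 \<Rightarrow> 'n heis L2" where
  "rot_L2 \<theta> u = abs_L2 (\<lambda>q. rep_L2 u (horizontal_rotation \<theta> q))"

text \<open>Rotations preserve null sets, so composition with them is independent of the
  representative fixed in the definition.\<close>

lemma rot_L2_abs:
  assumes "sq_integrable f"
  shows "rot_L2 \<theta> (abs_L2 f) = abs_L2 (\<lambda>q. f (horizontal_rotation \<theta> q))"
  unfolding rot_L2_def
    L2_eq_iff[OF sq_integrable_rotation[OF sq_integrable_rep_L2] sq_integrable_rotation[OF assms]]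
  by (rule AE_rotation[OF rep_abs_L2[OF assms]])

lemma L2_cases:
  obtains f where "sq_integrable f" "u = abs_L2 f"
  using sq_integrable_rep_L2[of u] abs_rep_L2[of u] by metis

lemma linear_rot_L2: "linear (rot_L2 \<theta>)"
proof
  fix u v :: "'a heis L2" and c :: real
  obtain f g where f: "sq_integrable f" "u = abs_L2 f" and g: "sq_integrable g" "v = abs_L2 g"
    by (metis L2_cases)
  show "rot_L2 \<theta> (u + v) = rot_L2 \<theta> u + rot_L2 \<theta> v"
    using f g by (simp add: abs_L2_add rot_L2_abs sq_integrable_add sq_integrable_rotation)
  show "rot_L2 \<theta> (c *\<^sub>R u) = c *\<^sub>R rot_L2 \<theta> u"
    using f by (simp add: abs_L2_scale rot_L2_abs sq_integrable_scale sq_integrable_rotation)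
qed

lemma rot_L2_add: "rot_L2 \<theta> (rot_L2 \<eta> u) = rot_L2 (\<theta> + \<eta>) u"
  by (cases u rule: L2_cases)
    (simp add: rot_L2_abs sq_integrable_rotation horizontal_rotation_add add.commute)

lemma rot_L2_0: "rot_L2 0 u = u"
  by (simp add: rot_L2_def)

lemma inner_rot_L2: "inner (rot_L2 \<theta> u) (rot_L2 \<theta> v) = inner u v"
proof (cases u rule: L2_cases, cases v rule: L2_cases)
  fix f g assume f: "sq_integrable f" "u = abs_L2 f" and g: "sq_integrable g" "v = abs_L2 g"
  then have "(\<lambda>q. f q * g q) \<in> borel_measurable borel" by (auto simp: sq_integrable_def)
  from integral_rotation[OF this] f g show ?thesis
    by (simp add: rot_L2_abs abs_L2_inner sq_integrable_rotation)
qed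

lemma unitary_rot_L2: "unitary (rot_L2 \<theta>) (rot_L2 (- \<theta>))"
  by standard (simp_all add: linear_rot_L2 linear_add[OF linear_rot_L2] linear_scale[OF linear_rot_L2]
      rot_L2_add rot_L2_0 inner_rot_L2)

text \<open>The graph over test functions is mapped into itself, and a continuous map preserves this
  for the closure. Square integrability of test functions and of their sub-Laplacians lets
  \<open>rot_L2\<close> be computed on them directly.\<close>

lemma sub_laplacian_sa_rotation:
  fixes u v :: "'a::finite heis L2"
  assumes "(u, v) \<in> sub_laplacian_sa"
  shows "(rot_L2 \<theta> u, rot_L2 \<theta> v) \<in> sub_laplacian_sa"
proof -
  let ?G = "{(abs_L2 f, abs_L2 (sub_laplacian f)) | f. test_function (f :: 'a heis \<Rightarrow> real)}"
  let ?T = "\<lambda>p :: 'a heis L2 \<times> 'a heis L2. (rot_L2 \<theta> (fst p), rot_L2 \<theta> (snd p))"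
  have "bounded_linear (rot_L2 \<theta> :: 'a heis L2 \<Rightarrow> _)"
    by (intro isometry_bounded_linear linear_rot_L2 inner_rot_L2)
  then have bl: "continuous_on UNIV (rot_L2 \<theta> :: 'a heis L2 \<Rightarrow> _)"
    by (rule linear_continuous_on)
  have cont: "continuous_on UNIV ?T"
    by (intro continuous_on_Pair continuous_on_compose2[OF bl continuous_on_fst[OF continuous_on_id]]
        continuous_on_compose2[OF bl continuous_on_snd[OF continuous_on_id]] subset_UNIV)
  have "?T ` ?G \<subseteq> ?G"
  proof
    fix p assume "p \<in> ?T ` ?G"
    then obtain f where f: "test_function f"
      and p: "p = (rot_L2 \<theta> (abs_L2 f), rot_L2 \<theta> (abs_L2 (sub_laplacian f)))" by auto
    have "sub_laplacian (\<lambda>q. f (horizontal_rotation \<theta> q)) = (\<lambda>q. sub_laplacian f (horizontal_rotation \<theta> q))"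
      by (intro ext sub_laplacian_rotation f)
    then have "p = (abs_L2 (\<lambda>q. f (horizontal_rotation \<theta> q)),
        abs_L2 (sub_laplacian (\<lambda>q. f (horizontal_rotation \<theta> q))))"
      by (simp only: p rot_L2_abs[OF test_function_sq_integrable[OF f]]
          rot_L2_abs[OF sub_laplacian_sq_integrable[OF f]])
    then show "p \<in> ?G" using test_function_rotation[OF f] by blast
  qed
  then have "?T ` ?G \<subseteq> closure ?G"
    by (rule subset_trans[OF _ closure_subset])
  then have sub: "?T ` closure ?G \<subseteq> closure ?G"
    by (rule image_closure_subset[OF continuous_on_subset[OF cont subset_UNIV] closed_closure])
  have "(u, v) \<in> closure ?G" using assms by (simp only: sub_laplacian_sa_def)
  then have "?T (u, v) \<in> closure ?G" by (rule subsetD[OF sub imageI])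
  then show ?thesis by (simp only: sub_laplacian_sa_def fst_conv snd_conv)
qed

lemma neg_laplacian_power_rotation:
  fixes u v :: "'a::finite heis L2"
  assumes "(u, v) \<in> neg_laplacian_power \<alpha>"
  shows "(rot_L2 \<theta> u, rot_L2 \<theta> v) \<in> neg_laplacian_power \<alpha>"
proof -
  interpret unitary "rot_L2 \<theta>" "rot_L2 (- \<theta>)" by (rule unitary_rot_L2)
  have neg: "(rot_L2 \<eta> u, rot_L2 \<eta> v) \<in> neg_op sub_laplacian_sa"
    if "(u, v) \<in> neg_op sub_laplacian_sa" for u v :: "'a heis L2" and \<eta>
    using that sub_laplacian_sa_rotation[of u "- v" \<eta>]
    by (auto simp: neg_op_def linear_neg[OF linear_rot_L2] intro!: exI[of _ "rot_L2 \<eta> (- v)"])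
  have "(u, v) \<in> neg_op sub_laplacian_sa \<longleftrightarrow> (rot_L2 (- \<theta>) u, rot_L2 (- \<theta>) v) \<in> neg_op sub_laplacian_sa"
    for u v :: "'a heis L2"
    using neg[of u v "- \<theta>"] neg[of "rot_L2 (- \<theta>) u" "rot_L2 (- \<theta>) v" \<theta>] by auto
  then show ?thesis
    using assms unfolding neg_laplacian_power_def by (rule spectral_fun_invariant)
qed

lemma neg_laplacian_power_unique:
  assumes "(u, v) \<in> neg_laplacian_power \<alpha>" "(u, v') \<in> neg_laplacian_power \<alpha>"
  shows "v = v'"
proof (rule spectral_fun_unique)
  show "(\<lambda>x. x powr (- \<alpha>)) \<in> borel_measurable borel" by simp
qed (use assms in \<open>simp_all add: neg_laplacian_power_def\<close>)

section \<open>Sobolev classes and the covariance\<close>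

lemma sobolev_rotation:
  assumes "f \<in> sobolev \<alpha>"
  shows "(\<lambda>q. f (horizontal_rotation \<theta> q)) \<in> sobolev \<alpha>"
proof -
  from assms obtain v where f: "sq_integrable f" and v: "(abs_L2 f, v) \<in> neg_laplacian_power \<alpha>"
    by (auto simp: sobolev_def)
  from neg_laplacian_power_rotation[OF v, of \<theta>] sq_integrable_rotation[OF f, of \<theta>] show ?thesis
    unfolding rot_L2_abs[OF f] sobolev_def by blast
qed

lemma sobolev_rotation_iff:
  "(\<lambda>q. f (horizontal_rotation \<theta> q)) \<in> sobolev \<alpha> \<longleftrightarrow> f \<in> sobolev \<alpha>"
  (is "?f \<in> _ \<longleftrightarrow> _")
proof
  assume "?f \<in> sobolev \<alpha>"
  from sobolev_rotation[OF this, of "- \<theta>"] show "f \<in> sobolev \<alpha>"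
    unfolding horizontal_rotation_add by simp
qed (rule sobolev_rotation)

lemma frac_lap_eq:
  assumes f: "f \<in> sobolev \<alpha>" and v: "(abs_L2 f, v) \<in> neg_laplacian_power \<alpha>"
  shows "frac_lap \<alpha> f = rep_L2 v"
proof -
  have "(THE v. (abs_L2 f, v) \<in> neg_laplacian_power \<alpha>) = v"
    using v by (rule the_equality) (rule neg_laplacian_power_unique[OF _ v])
  then show ?thesis using f by (simp add: frac_lap_def)
qed

lemma frac_lap_measurable [measurable]:
  fixes f :: "'a::finite heis \<Rightarrow> real"
  shows "frac_lap \<alpha> f \<in> borel_measurable borel"
proof -
  have "rep_L2 u \<in> borel_measurable borel" for u :: "'a heis L2"
    using sq_integrable_rep_L2[of u] by (simp add: sq_integrable_def)
  then show ?thesis by (simp add: frac_lap_def)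
qed

text \<open>Equality holds almost everywhere because \<open>rep_L2\<close> chooses representatives
  with no regard to rotations. Outside the Sobolev class both sides are 0, so the integral
  identities below cover every function and every time \<open>t\<close>.\<close>

lemma frac_lap_rotation:
  "AE q in lborel. frac_lap \<alpha> (\<lambda>q. f (horizontal_rotation \<theta> q)) q = frac_lap \<alpha> f (horizontal_rotation \<theta> q)"
proof (cases "f \<in> sobolev \<alpha>")
  case True
  then obtain v where v: "(abs_L2 f, v) \<in> neg_laplacian_power \<alpha>" by (auto simp: sobolev_def)
  have "(abs_L2 (\<lambda>q. f (horizontal_rotation \<theta> q)), rot_L2 \<theta> v) \<in> neg_laplacian_power \<alpha>"
    using neg_laplacian_power_rotation[OF v, of \<theta>] True by (simp add: sobolev_def rot_L2_abs)
  then have "frac_lap \<alpha> (\<lambda>q. f (horizontal_rotation \<theta> q)) = rep_L2 (rot_L2 \<theta> v)"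
    by (rule frac_lap_eq[OF sobolev_rotation[OF True]])
  moreover have "AE q in lborel. rep_L2 (rot_L2 \<theta> v) q = rep_L2 v (horizontal_rotation \<theta> q)"
    unfolding rot_L2_def by (rule rep_abs_L2[OF sq_integrable_rotation[OF sq_integrable_rep_L2]])
  ultimately show ?thesis by (simp add: frac_lap_eq[OF True v])
qed (simp add: frac_lap_def sobolev_rotation_iff)

lemma integral_frac_lap_rotation:
  "(\<integral>q. frac_lap \<alpha> (\<lambda>q. f (horizontal_rotation \<theta> q)) q * frac_lap \<alpha> (\<lambda>q. g (horizontal_rotation \<theta> q)) q \<partial>lborel)
    = (\<integral>q. frac_lap \<alpha> f q * frac_lap \<alpha> g q \<partial>lborel)"
proof -
  have "(\<integral>q. frac_lap \<alpha> (\<lambda>q. f (horizontal_rotation \<theta> q)) q * frac_lap \<alpha> (\<lambda>q. g (horizontal_rotation \<theta> q)) q \<partial>lborel)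
    = (\<integral>q. frac_lap \<alpha> f (horizontal_rotation \<theta> q) * frac_lap \<alpha> g (horizontal_rotation \<theta> q) \<partial>lborel)"
  proof (rule integral_cong_AE)
    show "AE q in lborel. frac_lap \<alpha> (\<lambda>q. f (horizontal_rotation \<theta> q)) q * frac_lap \<alpha> (\<lambda>q. g (horizontal_rotation \<theta> q)) q
        = frac_lap \<alpha> f (horizontal_rotation \<theta> q) * frac_lap \<alpha> g (horizontal_rotation \<theta> q)"
      using frac_lap_rotation[of \<alpha> f \<theta>] frac_lap_rotation[of \<alpha> g \<theta>] by eventually_elim simp
  qed measurable
  then show ?thesis
    using integral_rotation[of "\<lambda>q. frac_lap \<alpha> f q * frac_lap \<alpha> g q" \<theta>] by simp
qed

lemma nn_integral_frac_lap_rotation: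
  "(\<integral>\<^sup>+q. ennreal ((frac_lap \<alpha> (\<lambda>q. f (horizontal_rotation \<theta> q)) q)\<^sup>2) \<partial>lborel)
    = (\<integral>\<^sup>+q. ennreal ((frac_lap \<alpha> f q)\<^sup>2) \<partial>lborel)"
proof -
  have "(\<integral>\<^sup>+q. ennreal ((frac_lap \<alpha> (\<lambda>q. f (horizontal_rotation \<theta> q)) q)\<^sup>2) \<partial>lborel)
    = (\<integral>\<^sup>+q. ennreal ((frac_lap \<alpha> f (horizontal_rotation \<theta> q))\<^sup>2) \<partial>lborel)"
    by (rule nn_integral_cong_AE) (use frac_lap_rotation[of \<alpha> f \<theta>] in eventually_elim, simp)
  then show ?thesis
    using nn_integral_rotation[of "\<lambda>q. ennreal ((frac_lap \<alpha> f q)\<^sup>2)" \<theta>] by simp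
qed

lemma rotate_field_at: "rotate_field \<theta> \<phi> t = (\<lambda>q. \<phi> t (horizontal_rotation \<theta> q))"
  by (simp add: rotate_field_def fun_eq_iff)

lemma L2_sobolev_rotation:
  assumes "\<phi> \<in> L2_sobolev \<alpha>"
  shows "rotate_field \<theta> \<phi> \<in> L2_sobolev \<alpha>"
proof -
  from assms have \<phi>: "case_prod \<phi> \<in> borel_measurable (half_line \<Otimes>\<^sub>M lborel)"
    "AE t in half_line. \<phi> t \<in> sobolev \<alpha>"
    "(\<integral>\<^sup>+ t. (\<integral>\<^sup>+ q. ennreal ((frac_lap \<alpha> (\<phi> t) q)\<^sup>2) \<partial>lborel) \<partial>half_line) < \<infinity>"
    unfolding L2_sobolev_def by blast+
  have R: "horizontal_rotation \<theta> \<in> lborel \<rightarrow>\<^sub>M lborel" by simp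
  have "(\<lambda>p. (fst p, horizontal_rotation \<theta> (snd p))) \<in> half_line \<Otimes>\<^sub>M lborel \<rightarrow>\<^sub>M half_line \<Otimes>\<^sub>M lborel"
    by (intro measurable_Pair measurable_fst measurable_compose[OF measurable_snd R])
  from measurable_compose[OF this \<phi>(1)]
  have "case_prod (rotate_field \<theta> \<phi>) \<in> borel_measurable (half_line \<Otimes>\<^sub>M lborel)"
    by (simp add: rotate_field_at case_prod_beta')
  moreover have "AE t in half_line. rotate_field \<theta> \<phi> t \<in> sobolev \<alpha>"
    unfolding rotate_field_at sobolev_rotation_iff by (rule \<phi>(2))
  moreover have "(\<integral>\<^sup>+ t. (\<integral>\<^sup>+ q. ennreal ((frac_lap \<alpha> (rotate_field \<theta> \<phi> t) q)\<^sup>2) \<partial>lborel) \<partial>half_line) < \<infinity>"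
    unfolding rotate_field_at nn_integral_frac_lap_rotation by (rule \<phi>(3))
  ultimately show ?thesis unfolding L2_sobolev_def by blast
qed

text \<open>An equality of functions, not of classes: it gives injectivity on the index set, whose
  elements are functions.\<close>

lemma rotate_field_inverse: "rotate_field (- \<theta>) (rotate_field \<theta> \<phi>) = \<phi>"
  by (simp add: rotate_field_def[abs_def] horizontal_rotation_add)

theorem proposition3p6:
  fixes M :: "'w measure"
    and W :: "(real \<Rightarrow> 'n::finite heis \<Rightarrow> real) \<Rightarrow> 'w \<Rightarrow> real"
    and \<alpha> \<theta> :: real
  assumes "0 < \<alpha>" and "\<alpha> < (real CARD('n) + 1) / 2"
    and "prob_space M"
    and "centered_gaussian_family M (L2_sobolev \<alpha>) W"
    and "\<And>\<phi> \<psi>. \<phi> \<in> L2_sobolev \<alpha> \<Longrightarrow> \<psi> \<in> L2_sobolev \<alpha> \<Longrightarrow>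
      (\<integral>\<omega>. W \<phi> \<omega> * W \<psi> \<omega> \<partial>M)
        = (\<integral>t. (\<integral>q. frac_lap \<alpha> (\<phi> t) q * frac_lap \<alpha> (\<psi> t) q \<partial>lborel) \<partial>half_line)"
    and "0 \<le> \<theta>" and "\<theta> < 2 * pi"
  shows "(\<forall>\<phi>\<in>L2_sobolev \<alpha>. rotate_field \<theta> \<phi> \<in> (L2_sobolev \<alpha> :: (real \<Rightarrow> 'n heis \<Rightarrow> real) set)) \<and>
    family_law M (L2_sobolev \<alpha>) (\<lambda>\<phi>. W (rotate_field \<theta> \<phi>)) = family_law M (L2_sobolev \<alpha>) W"
proof
  show "\<forall>\<phi>\<in>L2_sobolev \<alpha>. rotate_field \<theta> \<phi> \<in> (L2_sobolev \<alpha> :: (real \<Rightarrow> 'n heis \<Rightarrow> real) set)"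
    by (intro ballI L2_sobolev_rotation)
  interpret prob_space M by fact
  show "family_law M (L2_sobolev \<alpha>) (\<lambda>\<phi>. W (rotate_field \<theta> \<phi>)) = family_law M (L2_sobolev \<alpha>) W"
  proof (rule centered_gaussian_family_law_eq)
    show "centered_gaussian_family M (L2_sobolev \<alpha>) (\<lambda>\<phi>. W (rotate_field \<theta> \<phi>))"
    proof (rule centered_gaussian_family_reindex[OF assms(4)])
      show "inj_on (rotate_field \<theta>) (L2_sobolev \<alpha>)"
        by (rule inj_on_inverseI[of _ "rotate_field (- \<theta>)"]) (rule rotate_field_inverse)
      show "rotate_field \<theta> ` L2_sobolev \<alpha> \<subseteq> L2_sobolev \<alpha>"
        using L2_sobolev_rotation by blast
    qed
    fix \<phi> \<psi> :: "real \<Rightarrow> 'n heis \<Rightarrow> real"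
    assume \<phi>\<psi>: "\<phi> \<in> L2_sobolev \<alpha>" "\<psi> \<in> L2_sobolev \<alpha>"
    \<comment> \<open>The covariance formula applies to the rotated pair because that pair stays in
      the index set; the rotation then disappears from the space integral separately at each
      time.\<close>
    show "(\<integral>\<omega>. W (rotate_field \<theta> \<phi>) \<omega> * W (rotate_field \<theta> \<psi>) \<omega> \<partial>M) = (\<integral>\<omega>. W \<phi> \<omega> * W \<psi> \<omega> \<partial>M)"
      unfolding assms(5)[OF \<phi>\<psi>] assms(5)[OF L2_sobolev_rotation[OF \<phi>\<psi>(1)] L2_sobolev_rotation[OF \<phi>\<psi>(2)]]
        rotate_field_at integral_frac_lap_rotation ..
  qed fact
qed

end
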